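(* Let $(z_k)_{k\ge 0}$ be a monotone (nondecreasing) sequence of positive numbers increasing to infinity with $\lim_{k\to\infty} z_k/z_{k-1}=1$. Let $c>0$ and let $(X_k)_{k\in\mathbb{N}}$ be independent random variables with values in $\mathbb{N}_0=\{0,1,2,\dots\}$ such that, with $q_k^0=\mathbf{P}\{X_k=0\}$ and $q_k^1=\mathbf{P}\{X_k=1\}$, $$q_k^0=(z_{k-1}/z_k)^c\quad\text{and}\quad q_k^1=q_k^0(1-q_k^0),\qquad k\in\mathbb{N}.$$ Then the sequence of point processes $\nu_n=\sum_{k=1}^\infty X_k\delta_{z_k/z_n}$, $n\in\mathbb{N}$, on $(0,\infty)$ converges vaguely in distribution to $\eta_c$ as $n\to\infty$. If, in addition, $\mathbf{E}X_k=\mathcal{O}(q_k^1)$ (i.e. there is $C>0$ with $\mathbf{E}X_k\le C q_k^1$ for all $k\in\mathbb{N}$), then $$\frac1{z_n}\sum_{k=1}^n z_kX_k\longrightarrow D_c\quad\text{in distribution as } n\to\infty.$$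
   Context: $\delta_x$ is the Dirac measure at $x$. For $c>0$, $\eta_c$ denotes the Poisson process on $(0,\infty)$ with intensity measure $c t^{-1}\,dt$. $D_c$ is the generalized Dickman random variable with parameter $c$: its law is that of $\int_0^1 t\,\eta_c(dt)$, the sum of the points of $\eta_c$ in $(0,1)$ (equivalently, the unique non-negative solution in law of $W=_d Q^{1/c}(W+1)$ with $Q$ uniform on $[0,1]$ independent of $W$). Point processes $\xi_n$ on $(0,\infty)$ converge vaguely in distribution to $\xi$ if they converge in distribution as random elements of the space of locally finite measures on $(0,\infty)$ with the vague topology; equivalently, $\int f\,d\xi_n\to\int f\,d\xi$ in distribution for every bounded non-negative continuous $f$ on $(0,\infty)$ with relatively compact support. *)

theory Defs
  imports "HOL-Probability.Probability"
begin

section \<open>Locally finite measures on the positive half-line and the vague topology\<close>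

definition pos_borel :: "real measure" where
  "pos_borel = restrict_space borel {0<..}"

text \<open>Bounded sets of the half-line are those that are relatively compact in it, hence bounded away
  from 0 as well as from infinity.\<close>

definition locally_finite_measures :: "real measure set" where
  "locally_finite_measures =
    {\<mu>. sets \<mu> = sets pos_borel \<and> (\<forall>K. compact K \<and> K \<subseteq> {0<..} \<longrightarrow> emeasure \<mu> K < \<infinity>)}"

text \<open>Non-negative continuous functions on the half-line with relatively compact support.
  They are automatically bounded; their values on \<open>{..0}\<close> play no role.\<close>

definition vague_test_functions :: "(real \<Rightarrow> real) set" where
  "vague_test_functions =
    {f. continuous_on {0<..} f \<and> (\<forall>t>0. 0 \<le> f t) \<and>
        (\<exists>K. compact K \<and> K \<subseteq> {0<..} \<and> (\<forall>t>0. t \<notin> K \<longrightarrow> f t = 0))}"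

text \<open>The coarsest topology that makes all maps \<open>\<mu> \<mapsto> \<integral> f d\<mu>\<close> continuous.\<close>

definition vague_topology :: "real measure topology" where
  "vague_topology = topology_generated_by
    {{\<mu> \<in> locally_finite_measures. (\<integral>t. f t \<partial>\<mu>) \<in> U} | f U. f \<in> vague_test_functions \<and> open U}"

lemma topspace_vague_topology: "topspace vague_topology = locally_finite_measures"
proof -
  have "(\<lambda>_. 0) \<in> vague_test_functions"
    by (auto simp: vague_test_functions_def intro!: exI[of _ "{}"])
  then have "{\<mu> \<in> locally_finite_measures. (\<integral>t. (\<lambda>_. 0) t \<partial>\<mu>) \<in> (UNIV :: real set)}
      \<in> {{\<mu> \<in> locally_finite_measures. (\<integral>t. f t \<partial>\<mu>) \<in> U} | f U. f \<in> vague_test_functions \<and> open U}"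
    by blast
  then show ?thesis
    unfolding vague_topology_def topology_generated_by_topspace by blast
qed


section \<open>Point processes\<close>

text \<open>A point process is an integer-valued locally finite random measure. Measurability is with
  respect to the evaluations \<open>\<mu> \<mapsto> \<mu> B\<close>; they generate the Borel sigma-algebra of the vague topology,
  which is Polish.\<close>

definition point_process :: "'a measure \<Rightarrow> ('a \<Rightarrow> real measure) \<Rightarrow> bool" where
  "point_process M \<xi> \<longleftrightarrow> prob_space M \<and>
    (\<forall>\<omega>\<in>space M. \<xi> \<omega> \<in> locally_finite_measures \<and>
       (\<forall>B\<in>sets pos_borel. emeasure (\<xi> \<omega>) B \<in> insert \<infinity> (range of_nat))) \<and>
    (\<forall>B\<in>sets pos_borel. (\<lambda>\<omega>. emeasure (\<xi> \<omega>) B) \<in> borel_measurable M)"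

text \<open>Convergence in distribution of random elements of a topological space. The \<open>n\<close>-th element may
  live on its own probability space.\<close>

definition converges_in_distribution ::
  "'s topology \<Rightarrow> (nat \<Rightarrow> 'a measure) \<Rightarrow> (nat \<Rightarrow> 'a \<Rightarrow> 's) \<Rightarrow> 'b measure \<Rightarrow> ('b \<Rightarrow> 's) \<Rightarrow> bool" where
  "converges_in_distribution T M \<xi> N \<eta> \<longleftrightarrow>
    (\<forall>F. continuous_map T euclideanreal F \<and> bounded (F ` topspace T) \<longrightarrow>
      (\<lambda>n. \<integral>\<omega>. F (\<xi> n \<omega>) \<partial>M n) \<longlonglongrightarrow> (\<integral>\<omega>. F (\<eta> \<omega>) \<partial>N))"

definition converges_vaguely_in_distribution ::
  "(nat \<Rightarrow> 'a measure) \<Rightarrow> (nat \<Rightarrow> 'a \<Rightarrow> real measure) \<Rightarrow> 'b measure \<Rightarrow> ('b \<Rightarrow> real measure) \<Rightarrow> bool" where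
  "converges_vaguely_in_distribution M \<xi> N \<eta> \<longleftrightarrow>
    (\<forall>n. point_process (M n) (\<xi> n)) \<and> point_process N \<eta> \<and>
    converges_in_distribution vague_topology M \<xi> N \<eta>"

text \<open>A Poisson process with intensity measure \<open>\<Lambda>\<close>. The probabilities are written out, rather than
  taken from \<^const>\<open>poisson_pmf\<close>, because that constant is only specified for positive rates, whereas
  \<open>\<Lambda> B = 0\<close> must be allowed. The Poisson distribution with infinite mean is the point mass at
  infinity.\<close>

definition poisson_process :: "'a measure \<Rightarrow> real measure \<Rightarrow> ('a \<Rightarrow> real measure) \<Rightarrow> bool" where
  "poisson_process N \<Lambda> \<eta> \<longleftrightarrow> point_process N \<eta> \<and>
    (\<forall>B\<in>sets pos_borel. emeasure \<Lambda> B < \<infinity> \<longrightarrow>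
      (\<forall>k. measure N {\<omega> \<in> space N. emeasure (\<eta> \<omega>) B = of_nat k}
         = measure \<Lambda> B ^ k / fact k * exp (- measure \<Lambda> B))) \<and>
    (\<forall>B\<in>sets pos_borel. emeasure \<Lambda> B = \<infinity> \<longrightarrow> (AE \<omega> in N. emeasure (\<eta> \<omega>) B = \<infinity>)) \<and>
    (\<forall>(I :: nat set) B. finite I \<and> B ` I \<subseteq> sets pos_borel \<and> disjoint_family_on B I \<longrightarrow>
      prob_space.indep_vars N (\<lambda>_. borel) (\<lambda>i \<omega>. emeasure (\<eta> \<omega>) (B i)) I)"

definition reciprocal_intensity :: "real \<Rightarrow> real measure" where
  "reciprocal_intensity c = density (restrict_space lborel {0<..}) (\<lambda>t. ennreal (c / t))"

text \<open>When \<open>\<eta>\<close> is a Poisson process with intensity \<open>reciprocal_intensity c\<close>, the integral below is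
  almost surely finite and its law is the generalized Dickman distribution with parameter \<open>c\<close>.\<close>

definition dickman_variable :: "('a \<Rightarrow> real measure) \<Rightarrow> 'a \<Rightarrow> real" where
  "dickman_variable \<eta> \<omega> = enn2real (\<integral>\<^sup>+t\<in>{0<..<1}. ennreal t \<partial>\<eta> \<omega>)"

text \<open>The measure \<open>\<Sum>k\<ge>1. m k \<delta>\<^bsub>x k\<^esub>\<close>, as the image under \<open>x\<close> of the measure on the positive
  integers with weights \<open>m\<close>.\<close>

definition weighted_dirac_sum :: "(nat \<Rightarrow> nat) \<Rightarrow> (nat \<Rightarrow> real) \<Rightarrow> real measure" where
  "weighted_dirac_sum m x = distr (density (count_space {1..}) (\<lambda>k. of_nat (m k))) pos_borel x"

lemma emeasure_weighted_dirac_sum: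
  assumes "\<And>k. k \<ge> 1 \<Longrightarrow> x k > 0" and B: "B \<in> sets pos_borel"
  shows "emeasure (weighted_dirac_sum m x) B
    = (\<integral>\<^sup>+k. of_nat (m k) * emeasure (return pos_borel (x k)) B \<partial>count_space {1..})"
proof -
  have x: "x \<in> measurable (density (count_space {1..}) (\<lambda>k. of_nat (m k))) pos_borel"
    using assms(1) by (auto simp: measurable_def pos_borel_def space_restrict_space)
  have "emeasure (weighted_dirac_sum m x) B
      = (\<integral>\<^sup>+k. of_nat (m k) * indicator (x -` B \<inter> {1..}) k \<partial>count_space {1..})"
    unfolding weighted_dirac_sum_def using x B
    by (subst emeasure_distr, simp, simp, subst emeasure_density) auto
  also have "\<dots> = (\<integral>\<^sup>+k. of_nat (m k) * emeasure (return pos_borel (x k)) B \<partial>count_space {1..})"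
    using B by (intro nn_integral_cong) (auto simp: indicator_def)
  finally show ?thesis .
qed

end

theory Submission
  imports Defs
begin

text \<open>
  Convergence of point processes. For every level \<open>L\<close> cut \<open>(2\<^sup>-\<^sup>L, 2\<^sup>L]\<close> into dyadic cells of length
  \<open>2\<^sup>-\<^sup>L\<close>. If a vaguely open set contains a counting measure, then for large \<open>L\<close> it contains every
  counting measure with the same numbers of points in the cells of level \<open>L\<close>
  (\<open>vaguely_open_contains_cell_class\<close>). Hence a vaguely continuous \<open>F\<close> is the pointwise limit from
  below of its infima over such classes. Each infimum depends on countably many values only, so that
  convergence of the joint laws of the counts and two applications of Fatou's lemma give
  \<open>E F(\<eta>) \<le> liminf E F(\<xi>\<^sub>n)\<close>; applied to \<open>F\<close> and \<open>- F\<close> this is convergence in distribution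
  (\<open>converges_vaguely_if_interval_counts_converge\<close>).

  The counts. The number of points of \<open>\<nu>\<^sub>n\<close> in \<open>(a, b]\<close> is the sum of \<open>X\<^sub>k\<close> over the window
  \<open>a z\<^sub>n < z\<^sub>k \<le> b z\<^sub>n\<close>; disjoint intervals give disjoint windows, hence independent counts. Write
  \<open>P(X\<^sub>k = 0) = exp (- r\<^sub>k)\<close> with \<open>r\<^sub>k = c (ln z\<^sub>k - ln z\<^sub>k\<^sub>-\<^sub>1)\<close>. Then the law of \<open>X\<^sub>k\<close> differs from the
  Poisson law with mean \<open>r\<^sub>k\<close> by \<open>O(r\<^sub>k\<^sup>2)\<close>, and these errors add up under convolution
  (\<open>poisson_approximation\<close>). The \<open>r\<^sub>k\<close> of a window telescope to \<open>c ln (b / a)\<close> in the limit, which is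
  the mass of \<open>(a, b]\<close> under the intensity \<open>c / t\<close>, while the sum of their squares vanishes because
  consecutive \<open>z\<^sub>k\<close> have ratio close to 1.

  The sums. Up to a null event, the rescaled sum is the integral of \<open>t\<close> over \<open>(0, 1]\<close> with respect to
  \<open>\<nu>\<^sub>n\<close>. The integrand is not a test function for the vague topology, so it is tapered to 0 near both ends. The
  points in the tapered regions contribute little in mean: the moment condition bounds \<open>z\<^sub>k E X\<^sub>k\<close> by a
  constant times \<open>z\<^sub>k - z\<^sub>k\<^sub>-\<^sub>1\<close>, and these increments telescope (\<open>sum_outside_taper_le\<close>). On the side of
  the limit, Campbell's formula shows that the integral of \<open>t\<close> over \<open>(0, 1)\<close> is almost surely finite,
  and dominated convergence removes the taper.
\<close>

section \<open>Measures that agree on fine grids are vaguely close\<close>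

definition counting_measures :: "real measure set" where
  "counting_measures = {\<mu> \<in> locally_finite_measures.
     \<forall>B\<in>sets pos_borel. emeasure \<mu> B \<in> insert \<infinity> (range of_nat)}"

definition cell :: "nat \<Rightarrow> nat \<Rightarrow> real set" where
  "cell L i = {real i / 2 ^ L <.. real (Suc i) / 2 ^ L}"

abbreviation cell_range :: "nat \<Rightarrow> nat set" where
  "cell_range L \<equiv> {1..<4 ^ L}"

text \<open>The cells with index in \<open>cell_range L\<close> tile the interval \<open>(2\<^sup>-\<^sup>L, 2\<^sup>L]\<close>. The counts are
  collected in a list because lists of natural numbers form a countable type.\<close>

definition cell_counts :: "nat \<Rightarrow> real measure \<Rightarrow> nat list" where
  "cell_counts L \<mu> = map (\<lambda>i. nat \<lfloor>measure \<mu> (cell L i)\<rfloor>) [1..<4 ^ L]"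

lemma sets_pos_borel: "A \<in> sets pos_borel \<longleftrightarrow> A \<in> sets borel \<and> A \<subseteq> {0<..}"
  unfolding pos_borel_def by (subst sets_restrict_space_iff) auto

lemma space_pos_borel [simp]: "space pos_borel = {0<..}"
  by (simp add: pos_borel_def space_restrict_space)

lemma interval_in_pos_borel: "0 \<le> a \<Longrightarrow> {a<..b} \<in> sets pos_borel"
  by (auto simp: sets_pos_borel)

lemma sets_locally_finite: "\<mu> \<in> locally_finite_measures \<Longrightarrow> sets \<mu> = sets pos_borel"
  by (simp add: locally_finite_measures_def)

lemma space_locally_finite: "\<mu> \<in> locally_finite_measures \<Longrightarrow> space \<mu> = {0<..}"
  using sets_eq_imp_space_eq[OF sets_locally_finite] by simp

lemma emeasure_interval_finite:
  assumes \<mu>: "\<mu> \<in> locally_finite_measures" and a: "0 < a"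
  shows "emeasure \<mu> {a<..b} < \<infinity>"
proof -
  have K: "compact {a..b}" "{a..b} \<subseteq> {0<..}" using a by auto
  have s: "{a..b} \<in> sets \<mu>"
    using K(2) by (subst sets_locally_finite[OF \<mu>]) (simp add: sets_pos_borel)
  have "emeasure \<mu> {a<..b} \<le> emeasure \<mu> {a..b}"
    by (rule emeasure_mono[OF _ s]) auto
  also have "\<dots> < \<infinity>" using \<mu> K by (auto simp: locally_finite_measures_def)
  finally show ?thesis .
qed

lemma cell_subset_pos: "cell L i \<subseteq> {0<..}"
  unfolding cell_def by (auto intro: le_less_trans[rotated])

lemma cell_in_pos_borel: "cell L i \<in> sets pos_borel"
  unfolding cell_def by (rule interval_in_pos_borel) simp

lemma emeasure_cell_finite:
  assumes "\<mu> \<in> locally_finite_measures" "i \<in> cell_range L"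
  shows "emeasure \<mu> (cell L i) < \<infinity>"
  unfolding cell_def by (rule emeasure_interval_finite) (use assms in auto)

lemma emeasure_counting_nat:
  assumes "\<mu> \<in> counting_measures" "B \<in> sets pos_borel" "emeasure \<mu> B < \<infinity>"
  shows "emeasure \<mu> B = of_nat (nat \<lfloor>measure \<mu> B\<rfloor>)" "measure \<mu> B = real (nat \<lfloor>measure \<mu> B\<rfloor>)"
proof -
  obtain k where k: "emeasure \<mu> B = of_nat k"
    using assms by (auto simp: counting_measures_def)
  then have "measure \<mu> B = real k"
    by (simp add: measure_def)
  then show "emeasure \<mu> B = of_nat (nat \<lfloor>measure \<mu> B\<rfloor>)" "measure \<mu> B = real (nat \<lfloor>measure \<mu> B\<rfloor>)"
    using k by simp_all
qed

lemma cell_counts_eq_iff: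
  assumes \<mu>: "\<mu> \<in> counting_measures"
  shows "cell_counts L \<mu> = v \<longleftrightarrow>
    length v = 4 ^ L - 1 \<and> (\<forall>i\<in>cell_range L. emeasure \<mu> (cell L i) = of_nat (v ! (i - 1)))"
proof -
  have \<mu>': "\<mu> \<in> locally_finite_measures" using \<mu> by (simp add: counting_measures_def)
  have *: "emeasure \<mu> (cell L i) = of_nat k \<longleftrightarrow> nat \<lfloor>measure \<mu> (cell L i)\<rfloor> = k"
    if "i \<in> cell_range L" for i k
    using emeasure_counting_nat[OF \<mu> cell_in_pos_borel emeasure_cell_finite[OF \<mu>' that]]
    by (metis of_nat_eq_iff)
  have "cell_counts L \<mu> = v \<longleftrightarrow> length v = 4 ^ L - 1 \<and> 
      (\<forall>j<4 ^ L - 1. nat \<lfloor>measure \<mu> (cell L (Suc j))\<rfloor> = v ! j)"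
    unfolding cell_counts_def list_eq_iff_nth_eq by auto
  also have "(\<forall>j<4 ^ L - 1. nat \<lfloor>measure \<mu> (cell L (Suc j))\<rfloor> = v ! j)
      \<longleftrightarrow> (\<forall>i\<in>cell_range L. nat \<lfloor>measure \<mu> (cell L i)\<rfloor> = v ! (i - 1))"
  proof safe
    fix i assume "\<forall>j<4 ^ L - 1. nat \<lfloor>measure \<mu> (cell L (Suc j))\<rfloor> = v ! j" and i: "i \<in> cell_range L"
    moreover have "i - 1 < 4 ^ L - 1" "Suc (i - 1) = i" using i by auto
    ultimately show "nat \<lfloor>measure \<mu> (cell L i)\<rfloor> = v ! (i - 1)" by metis
  next
    fix j :: nat assume A: "\<forall>i\<in>cell_range L. nat \<lfloor>measure \<mu> (cell L i)\<rfloor> = v ! (i - 1)" and j: "j < 4 ^ L - 1"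
    have "Suc j \<in> cell_range L" using j by auto
    with A show "nat \<lfloor>measure \<mu> (cell L (Suc j))\<rfloor> = v ! j" by force
  qed
  finally show ?thesis using * by auto
qed

lemma cell_unique:
  assumes "t \<in> cell L i" "t \<in> cell L j" shows "i = j"
proof -
  have "real i < real (Suc j)" "real j < real (Suc i)"
    using assms by (auto simp: cell_def field_simps)
  then show ?thesis by simp
qed

lemma disjoint_cells: "disjoint_family_on (cell L) I"
  unfolding disjoint_family_on_def using cell_unique by blast

lemma four_power: "(4 :: real) ^ L = 2 ^ L * 2 ^ L"
  using power_mult_distrib[of "2 :: real" 2 L] by simp

lemma ex_cell:
  assumes "1 / 2 ^ L < t" "t \<le> 2 ^ L"
  shows "\<exists>i\<in>cell_range L. t \<in> cell L i"
proof -
  define m where "m = nat \<lceil>t * 2 ^ L\<rceil>"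
  have t1: "1 < t * 2 ^ L" using assms(1) by (simp add: field_simps)
  then have m: "real m - 1 < t * 2 ^ L" "t * 2 ^ L \<le> real m"
    unfolding m_def by linarith+
  have "m \<ge> 2" using t1 m by linarith
  moreover have "t * 2 ^ L \<le> 4 ^ L"
  proof -
    have "t * 2 ^ L \<le> 2 ^ L * 2 ^ L" using assms(2) by (intro mult_right_mono) auto
    then show ?thesis by (simp add: four_power)
  qed
  then have "m \<le> 4 ^ L"
  proof -
    have "\<lceil>t * 2 ^ L\<rceil> \<le> 4 ^ L"
      using \<open>t * 2 ^ L \<le> 4 ^ L\<close> by (simp add: ceiling_le_iff)
    then show ?thesis by (simp add: m_def nat_le_iff)
  qed
  ultimately have "m - 1 \<in> cell_range L" by auto
  moreover have "t \<in> cell L (m - 1)"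
    using m \<open>m \<ge> 2\<close> by (simp add: cell_def field_simps of_nat_diff)
  ultimately show ?thesis by blast
qed

lemma sum_cell_indicator:
  fixes h :: "nat \<Rightarrow> real"
  assumes "i \<in> cell_range L" "t \<in> cell L i"
  shows "(\<Sum>j\<in>cell_range L. h j * indicator (cell L j) t) = h i"
proof -
  have "(\<Sum>j\<in>cell_range L. h j * indicator (cell L j) t) = (\<Sum>j\<in>cell_range L. if j = i then h i else 0)"
    using assms cell_unique by (intro sum.cong) (auto simp: indicator_def)
  then show ?thesis using assms by simp
qed

lemma sum_no_cell_indicator:
  fixes h :: "nat \<Rightarrow> real"
  assumes "\<not> (1 / 2 ^ L < t \<and> t \<le> 2 ^ L)"
  shows "(\<Sum>j\<in>cell_range L. h j * indicator (cell L j) t) = 0"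
proof (rule sum.neutral, safe)
  fix j assume j: "j \<in> cell_range L"
  have "t \<notin> cell L j"
  proof
    assume t: "t \<in> cell L j"
    have "1 / 2 ^ L \<le> real j / 2 ^ L" using j by (intro divide_right_mono) auto
    moreover have "real (Suc j) \<le> 4 ^ L"
      using j of_nat_le_iff[of "Suc j" "4 ^ L", where 'a = real] by auto
    then have "real (Suc j) \<le> 2 ^ L * 2 ^ L"
      by (simp add: four_power)
    then have "real (Suc j) / 2 ^ L \<le> 2 ^ L"
      by (simp add: divide_le_eq)
    ultimately show False using t assms by (auto simp: cell_def)
  qed
  then show "h j * indicator (cell L j) t = 0" by simp
qed

lemma test_function_measurable:
  assumes "f \<in> vague_test_functions" shows "f \<in> borel_measurable pos_borel"
  using assms unfolding vague_test_functions_def pos_borel_def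
  by (auto intro: borel_measurable_continuous_on_restrict)

lemma test_function_support:
  assumes "f \<in> vague_test_functions"
  obtains a b where "0 < a" "a < b" "\<And>t. 0 < t \<Longrightarrow> t \<notin> {a..b} \<Longrightarrow> f t = 0"
proof -
  obtain K where K: "compact K" "K \<subseteq> {0<..}" "\<And>t. 0 < t \<Longrightarrow> t \<notin> K \<Longrightarrow> f t = 0"
    using assms by (auto simp: vague_test_functions_def)
  show ?thesis
  proof (cases "K = {}")
    case True
    then show ?thesis using K that[of 1 2] by auto
  next
    case False
    obtain a where a: "a \<in> K" "\<And>t. t \<in> K \<Longrightarrow> a \<le> t"
      using compact_attains_inf[OF K(1) False] by auto
    obtain b where b: "b \<in> K" "\<And>t. t \<in> K \<Longrightarrow> t \<le> b"
      using compact_attains_sup[OF K(1) False] by auto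
    show ?thesis
    proof (rule that[of a "b + 1"])
      show "0 < a" using a K by auto
      show "a < b + 1" using a(1) b(2)[of a] by simp
      show "f t = 0" if "0 < t" "t \<notin> {a..b + 1}" for t
        using a(2)[of t] b(2)[of t] K(3)[of t] that by (cases "t \<in> K") auto
    qed
  qed
qed

lemma test_function_integrable:
  assumes f: "f \<in> vague_test_functions" and \<mu>: "\<mu> \<in> locally_finite_measures"
  shows "integrable \<mu> f"
proof -
  obtain a b where ab: "0 < a" "a < b" "\<And>t. 0 < t \<Longrightarrow> t \<notin> {a..b} \<Longrightarrow> f t = 0"
    using test_function_support[OF f] by blast
  have "continuous_on {a..b} f"
    using f ab(1) by (auto simp: vague_test_functions_def intro: continuous_on_subset)
  then have "bounded (f ` {a..b})"
    by (intro compact_imp_bounded compact_continuous_image) auto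
  then obtain C where C: "\<And>t. t \<in> {a..b} \<Longrightarrow> \<bar>f t\<bar> \<le> C"
    unfolding bounded_iff real_norm_def by blast
  have sp: "{a..b} \<in> sets \<mu>"
    using ab by (subst sets_locally_finite[OF \<mu>]) (auto simp: sets_pos_borel)
  have fin: "emeasure \<mu> {a..b} < \<infinity>"
  proof -
    have "compact {a..b}" "{a..b} \<subseteq> {0<..}" using ab(1) by auto
    then show ?thesis using \<mu> by (simp add: locally_finite_measures_def)
  qed
  have int: "integrable \<mu> (\<lambda>t. C * indicator {a..b} t)"
    using sp fin by (intro integrable_mult_right integrable_real_indicator)
  have "f \<in> borel_measurable \<mu>"
    using test_function_measurable[OF f] measurable_cong_sets[OF sets_locally_finite[OF \<mu>] refl] by auto
  then show ?thesis
    using ab C by (intro Bochner_Integration.integrable_bound[OF int])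
      (auto simp: space_locally_finite[OF \<mu>] indicator_def intro!: AE_I2 order_trans[OF C])
qed

lemma integral_step_function:
  fixes h :: "nat \<Rightarrow> real"
  assumes \<mu>: "\<mu> \<in> locally_finite_measures"
  shows "integrable \<mu> (\<lambda>t. \<Sum>i\<in>cell_range L. h i * indicator (cell L i) t)"
    and "(\<integral>t. (\<Sum>i\<in>cell_range L. h i * indicator (cell L i) t) \<partial>\<mu>)
      = (\<Sum>i\<in>cell_range L. h i * measure \<mu> (cell L i))"
proof -
  have i: "integrable \<mu> (\<lambda>t. h i * indicator (cell L i) t)" if "i \<in> cell_range L" for i
    using emeasure_cell_finite[OF \<mu> that] cell_in_pos_borel sets_locally_finite[OF \<mu>]
    by (intro integrable_mult_right integrable_real_indicator) auto
  show "integrable \<mu> (\<lambda>t. \<Sum>i\<in>cell_range L. h i * indicator (cell L i) t)"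
    by (intro Bochner_Integration.integrable_sum i)
  have sub: "cell L i \<inter> space \<mu> = cell L i" for i
    using cell_subset_pos[of L i] space_locally_finite[OF \<mu>] by auto
  show "(\<integral>t. (\<Sum>i\<in>cell_range L. h i * indicator (cell L i) t) \<partial>\<mu>)
      = (\<Sum>i\<in>cell_range L. h i * measure \<mu> (cell L i))"
    by (subst Bochner_Integration.integral_sum[OF i]) (simp_all add: sub)
qed

text \<open>Uniform continuity bounds the oscillation of \<open>f\<close> on each cell. The error is itself dominated by
  a step function, so that for another measure it can be read off from the cell counts alone.\<close>

lemma test_function_step_approximation:
  assumes f: "f \<in> vague_test_functions" and \<mu>: "\<mu> \<in> locally_finite_measures" and e: "0 < e"
  shows "\<forall>\<^sub>F L in sequentially. \<exists>h d.
     (\<forall>t>0. \<bar>f t - (\<Sum>i\<in>cell_range L. h i * indicator (cell L i) t)\<bar>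
        \<le> (\<Sum>i\<in>cell_range L. d i * indicator (cell L i) t)) \<and>
     (\<Sum>i\<in>cell_range L. d i * measure \<mu> (cell L i)) < e"
proof -
  obtain a b where ab: "0 < a" "a < b" "\<And>t. 0 < t \<Longrightarrow> t \<notin> {a..b} \<Longrightarrow> f t = 0"
    using test_function_support[OF f] by blast
  define K where "K = {a / 2 <.. b + 1}"
  have K: "K \<in> sets \<mu>" "emeasure \<mu> K < \<infinity>"
    using emeasure_interval_finite[OF \<mu>, of "a / 2" "b + 1"] ab
    by (auto simp: K_def sets_locally_finite[OF \<mu>] intro!: interval_in_pos_borel)
  define e' where "e' = e / (measure \<mu> K + 1)"
  have e': "0 < e'" "e' * measure \<mu> K < e"
  proof -
    have p: "0 < measure \<mu> K + 1" using measure_nonneg[of \<mu> K] by linarith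
    then show "0 < e'" using e by (simp add: e'_def)
    show "e' * measure \<mu> K < e" using p e by (simp add: e'_def divide_less_eq algebra_simps)
  qed
  have "continuous_on {a / 2..b + 1} f"
    using f ab(1) by (auto simp: vague_test_functions_def intro: continuous_on_subset)
  then have "uniformly_continuous_on {a / 2..b + 1} f"
    by (rule compact_uniformly_continuous) auto
  then obtain \<delta> where \<delta>: "0 < \<delta>"
      "\<And>s t. s \<in> {a / 2..b + 1} \<Longrightarrow> t \<in> {a / 2..b + 1} \<Longrightarrow> \<bar>s - t\<bar> < \<delta> \<Longrightarrow> \<bar>f s - f t\<bar> < e'"
    using e'(1) unfolding uniformly_continuous_on_def dist_real_def by metis
  have "(\<lambda>L. 1 / 2 ^ L :: real) \<longlonglongrightarrow> 0"
    using LIMSEQ_power_zero[of "1 / 2 :: real"] by (simp add: power_divide)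
  then have ev1: "\<forall>\<^sub>F L in sequentially. 1 / 2 ^ L < Min {\<delta>, a / 2, 1}"
    using \<delta>(1) ab(1) by (intro order_tendstoD(2)) auto
  obtain L0 where "b + 1 < (2 :: real) ^ L0"
    using real_arch_pow[of 2 "b + 1"] by auto
  then have "b + 1 \<le> (2 :: real) ^ L" if "L0 \<le> L" for L
    using power_increasing[OF that, of "2 :: real"] \<open>b + 1 < (2 :: real) ^ L0\<close> by linarith
  then have ev2: "\<forall>\<^sub>F L in sequentially. b + 1 \<le> (2 ^ L :: real)"
    unfolding eventually_sequentially by blast
  from ev1 ev2 show ?thesis
  proof eventually_elim
    case (elim L)
    then have L: "1 / 2 ^ L < \<delta>" "1 / 2 ^ L < a / 2" "1 / 2 ^ L < (1::real)" "b + 1 \<le> 2 ^ L" by auto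
    define s :: real where "s = 1 / 2 ^ L"
    note L' = L[folded s_def]
    \<comment> \<open>Sample \<open>f\<close> at right endpoints; cells not inside \<open>K\<close> miss the support of \<open>f\<close> altogether.\<close>
    define h where "h i = f (real (Suc i) / 2 ^ L)" for i
    define d where "d i = (if cell L i \<subseteq> K then e' else 0)" for i
    have "\<bar>f t - (\<Sum>i\<in>cell_range L. h i * indicator (cell L i) t)\<bar>
        \<le> (\<Sum>i\<in>cell_range L. d i * indicator (cell L i) t)" if t: "t > 0" for t
    proof (cases "1 / 2 ^ L < t \<and> t \<le> 2 ^ L")
      case False
      then have "t \<notin> {a..b}" using L ab by auto
      then show ?thesis unfolding sum_no_cell_indicator[OF False] using ab(3)[OF t] by simp
    next
      case True
      then obtain i where i: "i \<in> cell_range L" "t \<in> cell L i" using ex_cell by blast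
      define r where "r = real (Suc i) / 2 ^ L"
      have cell_eq: "cell L i = {r - 1 / 2 ^ L <.. r}"
        by (simp add: cell_def r_def field_simps)
      have tr: "t \<le> r" "r < t + 1 / 2 ^ L" using i(2) unfolding cell_eq by auto
      have "\<bar>f t - f r\<bar> \<le> d i"
      proof (cases "cell L i \<subseteq> K")
        case True
        have "t \<in> K" "r \<in> K" using True i(2) tr unfolding cell_eq by auto
        then have "\<bar>f t - f r\<bar> < e'" using tr L by (intro \<delta>(2)) (auto simp: K_def)
        then show ?thesis using True by (simp add: d_def)
      next
        case False
        have "t \<notin> {a..b} \<and> r \<notin> {a..b}"
        proof (rule ccontr)
          assume "\<not> ?thesis"
          then have "a \<le> r" "r \<le> b + s" using tr[folded s_def] L'(2) by auto
          then have "cell L i \<subseteq> K" using L' unfolding cell_eq[folded s_def] K_def by auto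
          then show False using False by simp
        qed
        then have "f t = 0" "f r = 0" using ab(3) t tr by auto
        then show ?thesis by (simp add: d_def False)
      qed
      then show ?thesis unfolding sum_cell_indicator[OF i] by (simp add: h_def r_def)
    qed
    moreover have "(\<Sum>i\<in>cell_range L. d i * measure \<mu> (cell L i)) < e"
    proof -
      let ?I = "{i \<in> cell_range L. cell L i \<subseteq> K}"
      have "(\<Sum>i\<in>cell_range L. d i * measure \<mu> (cell L i)) = (\<Sum>i\<in>?I. e' * measure \<mu> (cell L i))"
        by (rule sum.mono_neutral_cong_right) (auto simp: d_def)
      also have "\<dots> = e' * measure \<mu> (\<Union>i\<in>?I. cell L i)"
        using emeasure_cell_finite[OF \<mu>] cell_in_pos_borel sets_locally_finite[OF \<mu>] disjoint_cells
        by (subst measure_finite_Union) (auto simp: sum_distrib_left less_top[symmetric])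
      also have "\<dots> \<le> e' * measure \<mu> K"
        using K e'(1) cell_in_pos_borel sets_locally_finite[OF \<mu>]
        by (intro mult_left_mono measure_mono_fmeasurable) (auto simp: fmeasurable_def)
      also have "\<dots> < e" by (rule e'(2))
      finally show ?thesis .
    qed
    ultimately show ?case by blast
  qed
qed

lemma integral_close_if_cell_counts_eq:
  assumes f: "f \<in> vague_test_functions" and \<mu>: "\<mu> \<in> counting_measures" and e: "0 < e"
  shows "\<forall>\<^sub>F L in sequentially. \<forall>\<nu>\<in>counting_measures. cell_counts L \<nu> = cell_counts L \<mu> \<longrightarrow>
     \<bar>(\<integral>t. f t \<partial>\<nu>) - (\<integral>t. f t \<partial>\<mu>)\<bar> < e"
proof -
  have \<mu>': "\<mu> \<in> locally_finite_measures" using \<mu> by (simp add: counting_measures_def)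
  from test_function_step_approximation[OF f \<mu>', of "e / 2"] e
  have "\<forall>\<^sub>F L in sequentially. \<exists>h d.
     (\<forall>t>0. \<bar>f t - (\<Sum>i\<in>cell_range L. h i * indicator (cell L i) t)\<bar>
        \<le> (\<Sum>i\<in>cell_range L. d i * indicator (cell L i) t)) \<and>
     (\<Sum>i\<in>cell_range L. d i * measure \<mu> (cell L i)) < e / 2" by simp
  then show ?thesis
  proof eventually_elim
    case (elim L)
    then obtain h d where hd:
      "\<And>t. t > 0 \<Longrightarrow> \<bar>f t - (\<Sum>i\<in>cell_range L. h i * indicator (cell L i) t)\<bar>
        \<le> (\<Sum>i\<in>cell_range L. d i * indicator (cell L i) t)"
      "(\<Sum>i\<in>cell_range L. d i * measure \<mu> (cell L i)) < e / 2" by blast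
    have close: "\<bar>(\<integral>t. f t \<partial>\<nu>) - (\<Sum>i\<in>cell_range L. h i * measure \<mu> (cell L i))\<bar> < e / 2"
      if \<nu>: "\<nu> \<in> counting_measures" and eq: "cell_counts L \<nu> = cell_counts L \<mu>" for \<nu>
    proof -
      have \<nu>': "\<nu> \<in> locally_finite_measures" using \<nu> by (simp add: counting_measures_def)
      have same: "measure \<nu> (cell L i) = measure \<mu> (cell L i)" if "i \<in> cell_range L" for i
        using cell_counts_eq_iff[OF \<nu>, of L "cell_counts L \<mu>"] cell_counts_eq_iff[OF \<mu>, of L "cell_counts L \<mu>"]
          eq that by (simp add: measure_def)
      note step = integral_step_function[where L = L, OF \<nu>']
      note int = test_function_integrable[OF f \<nu>']
      have "(\<integral>t. f t \<partial>\<nu>) - (\<Sum>i\<in>cell_range L. h i * measure \<nu> (cell L i))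
          = (\<integral>t. f t - (\<Sum>i\<in>cell_range L. h i * indicator (cell L i) t) \<partial>\<nu>)"
        using step int by (subst Bochner_Integration.integral_diff) auto
      also have "\<bar>\<dots>\<bar> \<le> (\<integral>t. (\<Sum>i\<in>cell_range L. d i * indicator (cell L i) t) \<partial>\<nu>)"
        using hd(1) int step space_locally_finite[OF \<nu>']
        by (intro integral_abs_bound[THEN order_trans] integral_mono integrable_abs) auto
      also have "\<dots> = (\<Sum>i\<in>cell_range L. d i * measure \<mu> (cell L i))"
        unfolding step(2) by (simp add: same)
      finally show ?thesis using hd(2) same by simp
    qed
    show ?case
    proof safe
      fix \<nu> assume "\<nu> \<in> counting_measures" "cell_counts L \<nu> = cell_counts L \<mu>"
      from close[OF this] close[OF \<mu> refl]
      show "\<bar>(\<integral>t. f t \<partial>\<nu>) - (\<integral>t. f t \<partial>\<mu>)\<bar> < e" by linarith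
    qed
  qed
qed

text \<open>It suffices to treat subbasic open sets, because finite intersections and unions preserve the
  property; there it says that the integral of a test function is nearly determined by the counts.\<close>

lemma vaguely_open_contains_cell_class:
  assumes W: "openin vague_topology W" and \<mu>: "\<mu> \<in> W" "\<mu> \<in> counting_measures"
  shows "\<forall>\<^sub>F L in sequentially. \<forall>\<nu>\<in>counting_measures. cell_counts L \<nu> = cell_counts L \<mu> \<longrightarrow> \<nu> \<in> W"
proof -
  have "generate_topology_on {{\<mu> \<in> locally_finite_measures. (\<integral>t. f t \<partial>\<mu>) \<in> U} | f U.
      f \<in> vague_test_functions \<and> open U} W"
    using W unfolding vague_topology_def by (rule openin_topology_generated_by)
  then show ?thesis using \<mu>(1)
  proof induction
    case Empty then show ?case by simp
  next
    case (Int A B)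
    then have "\<forall>\<^sub>F L in sequentially. \<forall>\<nu>\<in>counting_measures. cell_counts L \<nu> = cell_counts L \<mu> \<longrightarrow> \<nu> \<in> A"
      "\<forall>\<^sub>F L in sequentially. \<forall>\<nu>\<in>counting_measures. cell_counts L \<nu> = cell_counts L \<mu> \<longrightarrow> \<nu> \<in> B" by auto
    then show ?case by eventually_elim auto
  next
    case (UN K)
    then obtain A where A: "A \<in> K" "\<mu> \<in> A" by auto
    from UN.IH[OF this] show ?case by eventually_elim (use A in auto)
  next
    case (Basis A)
    then obtain f U where fU: "f \<in> vague_test_functions" "open U"
      "A = {\<mu> \<in> locally_finite_measures. (\<integral>t. f t \<partial>\<mu>) \<in> U}" by blast
    then obtain e where e: "0 < e" "\<And>y. \<bar>y - (\<integral>t. f t \<partial>\<mu>)\<bar> < e \<Longrightarrow> y \<in> U"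
      using Basis.prems unfolding open_dist dist_real_def by auto
    from integral_close_if_cell_counts_eq[OF fU(1) \<mu>(2) e(1)] show ?case
      by eventually_elim (use e(2) fU(3) in \<open>auto simp: counting_measures_def\<close>)
  qed
qed

section \<open>A criterion for vague convergence in distribution\<close>

lemma nn_integral_countable_valued:
  fixes V :: "'a \<Rightarrow> 'c :: countable" and g :: "'c \<Rightarrow> ennreal"
  assumes V [measurable]: "V \<in> measurable M (count_space UNIV)"
  shows "(\<integral>\<^sup>+\<omega>. g (V \<omega>) \<partial>M) = (\<integral>\<^sup>+v. g v * emeasure M {\<omega> \<in> space M. V \<omega> = v} \<partial>count_space UNIV)"
proof -
  have "(\<integral>\<^sup>+\<omega>. g (V \<omega>) \<partial>M)
      = (\<integral>\<^sup>+\<omega>. \<integral>\<^sup>+v. g v * indicator {\<omega> \<in> space M. V \<omega> = v} \<omega> \<partial>count_space UNIV \<partial>M)"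
  proof (rule nn_integral_cong)
    fix \<omega> assume \<omega>: "\<omega> \<in> space M"
    have "(\<integral>\<^sup>+v. g v * indicator {\<omega> \<in> space M. V \<omega> = v} \<omega> \<partial>count_space UNIV)
        = (\<integral>\<^sup>+v. g v * indicator {V \<omega>} v \<partial>count_space UNIV)"
      using \<omega> by (intro nn_integral_cong) (auto simp: indicator_def)
    also have "\<dots> = g (V \<omega>)" by (subst nn_integral_indicator_singleton) auto
    finally show "g (V \<omega>) = (\<integral>\<^sup>+v. g v * indicator {\<omega> \<in> space M. V \<omega> = v} \<omega> \<partial>count_space UNIV)" ..
  qed
  also have "\<dots> = (\<integral>\<^sup>+v. \<integral>\<^sup>+\<omega>. g v * indicator {\<omega> \<in> space M. V \<omega> = v} \<omega> \<partial>M \<partial>count_space UNIV)"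
    by (rule nn_integral_count_space_nn_integral) auto
  also have "\<dots> = (\<integral>\<^sup>+v. g v * emeasure M {\<omega> \<in> space M. V \<omega> = v} \<partial>count_space UNIV)"
    by (intro nn_integral_cong) (auto simp: nn_integral_cmult)
  finally show ?thesis .
qed

text \<open>For a fixed value \<open>v\<close> the probabilities converge, and the expectation is a sum over the values;
  so this is Fatou's lemma for counting measure. The case \<open>g v = \<infinity>\<close> needs separate treatment because
  multiplication by infinity is not continuous at 0.\<close>

lemma fatou_countable_valued:
  fixes V :: "nat \<Rightarrow> 'a \<Rightarrow> 'c :: countable" and W :: "'b \<Rightarrow> 'c" and g :: "'c \<Rightarrow> ennreal"
  assumes "\<And>n. prob_space (M n)" "prob_space N"
    and V: "\<And>n. V n \<in> measurable (M n) (count_space UNIV)"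
    and W: "W \<in> measurable N (count_space UNIV)"
    and lim: "\<And>v. (\<lambda>n. measure (M n) {\<omega> \<in> space (M n). V n \<omega> = v})
      \<longlonglongrightarrow> measure N {\<omega> \<in> space N. W \<omega> = v}"
  shows "(\<integral>\<^sup>+\<omega>. g (W \<omega>) \<partial>N) \<le> liminf (\<lambda>n. \<integral>\<^sup>+\<omega>. g (V n \<omega>) \<partial>M n)"
proof -
  interpret N: prob_space N by fact
  have lim': "(\<lambda>n. g v * emeasure (M n) {\<omega> \<in> space (M n). V n \<omega> = v})
      \<longlonglongrightarrow> g v * emeasure N {\<omega> \<in> space N. W \<omega> = v}" if "g v < \<infinity>" for v
  proof -
    have eq: "emeasure (M n) A = ennreal (measure (M n) A)" for n A
      using assms(1) by (meson finite_measure.emeasure_eq_measure prob_space.finite_measure)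
    show ?thesis unfolding eq N.emeasure_eq_measure
      using that by (intro ennreal_tendsto_cmult tendsto_ennrealI lim) auto
  qed
  have lower: "g v * emeasure N {\<omega> \<in> space N. W \<omega> = v}
      \<le> liminf (\<lambda>n. g v * emeasure (M n) {\<omega> \<in> space (M n). V n \<omega> = v})" for v
  proof (cases "g v < \<infinity>")
    case True
    from lim_imp_Liminf[OF _ lim'[OF this]] show ?thesis by simp
  next
    case False
    then have g: "g v = \<top>" by (simp add: less_top[symmetric])
    show ?thesis
    proof (cases "measure N {\<omega> \<in> space N. W \<omega> = v} = 0")
      case True
      then show ?thesis by (simp add: N.emeasure_eq_measure)
    next
      case False
      then have "0 < measure N {\<omega> \<in> space N. W \<omega> = v}"
        using measure_nonneg[of N "{\<omega> \<in> space N. W \<omega> = v}"] by linarith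
      then have "\<forall>\<^sub>F n in sequentially. 0 < measure (M n) {\<omega> \<in> space (M n). V n \<omega> = v}"
        using lim order_tendstoD(1) by blast
      then have "\<forall>\<^sub>F n in sequentially. \<top> \<le> g v * emeasure (M n) {\<omega> \<in> space (M n). V n \<omega> = v}"
      proof eventually_elim
        case (elim n)
        then have "emeasure (M n) {\<omega> \<in> space (M n). V n \<omega> = v} \<noteq> 0"
          by (auto simp: measure_def)
        then show ?case by (simp add: g ennreal_top_mult)
      qed
      then have "\<top> \<le> liminf (\<lambda>n. g v * emeasure (M n) {\<omega> \<in> space (M n). V n \<omega> = v})"
        by (rule Liminf_bounded)
      then show ?thesis by (simp add: top_unique)
    qed
  qed
  have "(\<integral>\<^sup>+\<omega>. g (W \<omega>) \<partial>N) = (\<integral>\<^sup>+v. g v * emeasure N {\<omega> \<in> space N. W \<omega> = v} \<partial>count_space UNIV)"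
    by (rule nn_integral_countable_valued[OF W])
  also have "\<dots> \<le> (\<integral>\<^sup>+v. liminf (\<lambda>n. g v * emeasure (M n) {\<omega> \<in> space (M n). V n \<omega> = v}) \<partial>count_space UNIV)"
    by (intro nn_integral_mono lower)
  also have "\<dots> \<le> liminf (\<lambda>n. \<integral>\<^sup>+v. g v * emeasure (M n) {\<omega> \<in> space (M n). V n \<omega> = v} \<partial>count_space UNIV)"
    by (rule nn_integral_liminf) simp
  also have "\<dots> = liminf (\<lambda>n. \<integral>\<^sup>+\<omega>. g (V n \<omega>) \<partial>M n)"
    by (simp add: nn_integral_countable_valued[OF V])
  finally show ?thesis .
qed

lemma point_process_counting:
  "point_process M \<xi> \<Longrightarrow> \<omega> \<in> space M \<Longrightarrow> \<xi> \<omega> \<in> counting_measures"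
  by (auto simp: point_process_def counting_measures_def)

lemma point_process_locally_finite:
  "point_process M \<xi> \<Longrightarrow> \<omega> \<in> space M \<Longrightarrow> \<xi> \<omega> \<in> locally_finite_measures"
  by (simp add: point_process_def)

lemma point_process_emeasure_measurable:
  "point_process M \<xi> \<Longrightarrow> B \<in> sets pos_borel \<Longrightarrow> (\<lambda>\<omega>. emeasure (\<xi> \<omega>) B) \<in> borel_measurable M"
  by (simp add: point_process_def)

lemma cell_counts_eq_event:
  assumes "point_process M \<xi>"
  shows "{\<omega> \<in> space M. cell_counts L (\<xi> \<omega>) = v} = {\<omega> \<in> space M. length v = 4 ^ L - 1 \<and>
      (\<forall>i\<in>cell_range L. emeasure (\<xi> \<omega>) (cell L i) = of_nat (v ! (i - 1)))}"
  using cell_counts_eq_iff[OF point_process_counting[OF assms]] by blast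

lemma cell_counts_measurable:
  assumes \<xi>: "point_process M \<xi>"
  shows "(\<lambda>\<omega>. cell_counts L (\<xi> \<omega>)) \<in> measurable M (count_space UNIV)"
proof -
  have [measurable]: "(\<lambda>\<omega>. emeasure (\<xi> \<omega>) (cell L i)) \<in> borel_measurable M" for i
    by (rule point_process_emeasure_measurable[OF \<xi> cell_in_pos_borel])
  have "{\<omega> \<in> space M. cell_counts L (\<xi> \<omega>) = v} \<in> sets M" for v
    unfolding cell_counts_eq_event[OF \<xi>] by measurable
  then show ?thesis
    by (subst measurable_count_space_eq_countable) (auto simp: vimage_def Int_def conj_commute)
qed

text \<open>The infimum of \<open>F\<close> over the counting measures with given cell counts. On classes without members
  it is an unspecified number, which is harmless since the counts of a point process never take such
  values.\<close>

definition cell_class_Inf :: "(real measure \<Rightarrow> real) \<Rightarrow> nat \<Rightarrow> nat list \<Rightarrow> real" where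
  "cell_class_Inf F L v = Inf (F ` {\<nu> \<in> counting_measures. cell_counts L \<nu> = v})"

lemma cell_class_Inf_le:
  assumes "\<And>\<nu>. \<nu> \<in> counting_measures \<Longrightarrow> b \<le> F \<nu>" and "\<mu> \<in> counting_measures"
  shows "cell_class_Inf F L (cell_counts L \<mu>) \<le> F \<mu>"
  unfolding cell_class_Inf_def
  by (intro cInf_lower bdd_belowI[of _ b]) (use assms in auto)

lemma cell_class_Inf_tendsto:
  assumes F: "continuous_map vague_topology euclideanreal F"
    and b: "\<And>\<nu>. \<nu> \<in> counting_measures \<Longrightarrow> b \<le> F \<nu>" and \<mu>: "\<mu> \<in> counting_measures"
  shows "(\<lambda>L. cell_class_Inf F L (cell_counts L \<mu>)) \<longlonglongrightarrow> F \<mu>"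
proof (rule order_tendstoI)
  fix y assume y: "y < F \<mu>"
  define y' where "y' = (y + F \<mu>) / 2"
  have y': "y < y'" "y' < F \<mu>" using y by (auto simp: y'_def)
  have "openin vague_topology {\<nu> \<in> topspace vague_topology. F \<nu> \<in> {y'<..}}"
    using F by (rule openin_continuous_map_preimage) auto
  moreover have "\<mu> \<in> {\<nu> \<in> topspace vague_topology. F \<nu> \<in> {y'<..}}"
    using \<mu> y' by (auto simp: topspace_vague_topology counting_measures_def)
  ultimately have "\<forall>\<^sub>F L in sequentially. \<forall>\<nu>\<in>counting_measures. cell_counts L \<nu> = cell_counts L \<mu> \<longrightarrow>
      \<nu> \<in> {\<nu> \<in> topspace vague_topology. F \<nu> \<in> {y'<..}}"
    using \<mu> by (intro vaguely_open_contains_cell_class)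
  then show "\<forall>\<^sub>F L in sequentially. y < cell_class_Inf F L (cell_counts L \<mu>)"
  proof eventually_elim
    case (elim L)
    have "y' \<le> cell_class_Inf F L (cell_counts L \<mu>)"
      unfolding cell_class_Inf_def using elim \<mu> by (intro cInf_greatest) (auto intro: less_imp_le)
    then show ?case using y' by simp
  qed
next
  fix y assume "F \<mu> < y"
  then show "\<forall>\<^sub>F L in sequentially. cell_class_Inf F L (cell_counts L \<mu>) < y"
    using cell_class_Inf_le[where F = F, OF b \<mu>] by (intro always_eventually) (auto intro: le_less_trans)
qed

text \<open>The random measures are measurable with respect to the evaluations only, whereas \<open>F\<close> is
  continuous for the vague topology. The bridge is that \<open>F\<close> is a limit of functions of the cell
  counts.\<close>

lemma vaguely_continuous_measurable:
  assumes \<xi>: "point_process M \<xi>" and F: "continuous_map vague_topology euclideanreal F"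
    and b: "\<And>\<nu>. \<nu> \<in> counting_measures \<Longrightarrow> b \<le> F \<nu>"
  shows "(\<lambda>\<omega>. F (\<xi> \<omega>)) \<in> borel_measurable M"
proof (rule borel_measurable_LIMSEQ_real)
  show "(\<lambda>L. cell_class_Inf F L (cell_counts L (\<xi> \<omega>))) \<longlonglongrightarrow> F (\<xi> \<omega>)" if "\<omega> \<in> space M" for \<omega>
    using cell_class_Inf_tendsto[OF F b] point_process_counting[OF \<xi> that] by blast
  show "(\<lambda>\<omega>. cell_class_Inf F L (cell_counts L (\<xi> \<omega>))) \<in> borel_measurable M" for L
    by (rule measurable_compose[OF cell_counts_measurable[OF \<xi>]]) simp
qed

lemma expectation_shifted_vaguely_continuous:
  assumes \<zeta>: "point_process R \<zeta>" and F: "continuous_map vague_topology euclideanreal F"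
    and b: "\<And>\<nu>. \<nu> \<in> locally_finite_measures \<Longrightarrow> \<bar>F \<nu>\<bar> \<le> b"
  shows "(\<integral>\<^sup>+\<omega>. ennreal (b + F (\<zeta> \<omega>)) \<partial>R) = ennreal (b + (\<integral>\<omega>. F (\<zeta> \<omega>) \<partial>R))"
    and "0 \<le> b + (\<integral>\<omega>. F (\<zeta> \<omega>) \<partial>R)"
proof -
  have b': "- b \<le> F \<nu>" if "\<nu> \<in> counting_measures" for \<nu>
    using b[of \<nu>] that by (auto simp: counting_measures_def)
  interpret prob_space R using \<zeta> by (simp add: point_process_def)
  have bd: "\<bar>F (\<zeta> \<omega>)\<bar> \<le> b" if "\<omega> \<in> space R" for \<omega>
    using b point_process_locally_finite[OF \<zeta> that] .
  have i: "integrable R (\<lambda>\<omega>. F (\<zeta> \<omega>))"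
    using vaguely_continuous_measurable[OF \<zeta> F b'] bd by (intro integrable_const_bound[of _ b]) auto
  have e: "(\<integral>\<omega>. b + F (\<zeta> \<omega>) \<partial>R) = b + (\<integral>\<omega>. F (\<zeta> \<omega>) \<partial>R)"
    using i by (simp add: prob_space)
  have ge: "0 \<le> b + F (\<zeta> \<omega>)" if "\<omega> \<in> space R" for \<omega> using bd[OF that] by linarith
  show "0 \<le> b + (\<integral>\<omega>. F (\<zeta> \<omega>) \<partial>R)"
    unfolding e[symmetric] by (intro integral_nonneg_AE AE_I2 ge)
  show "(\<integral>\<^sup>+\<omega>. ennreal (b + F (\<zeta> \<omega>)) \<partial>R) = ennreal (b + (\<integral>\<omega>. F (\<zeta> \<omega>) \<partial>R))"
    unfolding e[symmetric] using i ge by (intro nn_integral_eq_integral) auto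
qed

text \<open>Fatou's lemma is used twice: at a fixed level to let \<open>n\<close> tend to infinity, and for the limit
  process to let the level tend to infinity. The shift by the bound \<open>b\<close> makes all integrands
  non-negative.\<close>

lemma liminf_expectation_vaguely_continuous:
  assumes \<xi>: "\<And>n. point_process (M n) (\<xi> n)" and \<eta>: "point_process N \<eta>"
    and lim: "\<And>L v. (\<lambda>n. measure (M n) {\<omega> \<in> space (M n). cell_counts L (\<xi> n \<omega>) = v})
      \<longlonglongrightarrow> measure N {\<omega> \<in> space N. cell_counts L (\<eta> \<omega>) = v}"
    and F: "continuous_map vague_topology euclideanreal F"
    and b: "\<And>\<nu>. \<nu> \<in> locally_finite_measures \<Longrightarrow> \<bar>F \<nu>\<bar> \<le> b" and y: "y < (\<integral>\<omega>. F (\<eta> \<omega>) \<partial>N)"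
  shows "\<forall>\<^sub>F n in sequentially. y < (\<integral>\<omega>. F (\<xi> n \<omega>) \<partial>M n)"
proof -
  have b': "- b \<le> F \<nu>" if "\<nu> \<in> counting_measures" for \<nu>
    using b[of \<nu>] that by (auto simp: counting_measures_def)
  note nn = expectation_shifted_vaguely_continuous[OF _ F b]
  have pM: "prob_space (M n)" for n using \<xi> by (simp add: point_process_def)
  have pN: "prob_space N" using \<eta> by (simp add: point_process_def)
  let ?G = "\<lambda>L v. ennreal (b + cell_class_Inf F L v)"
  have level: "(\<integral>\<^sup>+\<omega>. ?G L (cell_counts L (\<eta> \<omega>)) \<partial>N) \<le> liminf (\<lambda>n. \<integral>\<^sup>+\<omega>. ennreal (b + F (\<xi> n \<omega>)) \<partial>M n)" for L
  proof -
    have "(\<integral>\<^sup>+\<omega>. ?G L (cell_counts L (\<eta> \<omega>)) \<partial>N) \<le> liminf (\<lambda>n. \<integral>\<^sup>+\<omega>. ?G L (cell_counts L (\<xi> n \<omega>)) \<partial>M n)"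
      by (rule fatou_countable_valued[OF pM pN cell_counts_measurable[OF \<xi>] cell_counts_measurable[OF \<eta>] lim])
    also have "\<dots> \<le> liminf (\<lambda>n. \<integral>\<^sup>+\<omega>. ennreal (b + F (\<xi> n \<omega>)) \<partial>M n)"
      using cell_class_Inf_le[where F = F, OF b'] point_process_counting[OF \<xi>]
      by (intro Liminf_mono always_eventually allI nn_integral_mono ennreal_leI add_left_mono) blast
    finally show ?thesis .
  qed
  have "(\<integral>\<^sup>+\<omega>. ennreal (b + F (\<eta> \<omega>)) \<partial>N)
      = (\<integral>\<^sup>+\<omega>. liminf (\<lambda>L. ?G L (cell_counts L (\<eta> \<omega>))) \<partial>N)"
  proof (rule nn_integral_cong)
    fix \<omega> assume "\<omega> \<in> space N"
    then have "(\<lambda>L. cell_class_Inf F L (cell_counts L (\<eta> \<omega>))) \<longlonglongrightarrow> F (\<eta> \<omega>)"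
      using cell_class_Inf_tendsto[OF F b'] point_process_counting[OF \<eta>] by blast
    then have "(\<lambda>L. ?G L (cell_counts L (\<eta> \<omega>))) \<longlonglongrightarrow> ennreal (b + F (\<eta> \<omega>))"
      by (intro tendsto_ennrealI tendsto_add tendsto_const)
    then show "ennreal (b + F (\<eta> \<omega>)) = liminf (\<lambda>L. ?G L (cell_counts L (\<eta> \<omega>)))"
      by (intro lim_imp_Liminf[symmetric]) simp_all
  qed
  also have "\<dots> \<le> liminf (\<lambda>L. \<integral>\<^sup>+\<omega>. ?G L (cell_counts L (\<eta> \<omega>)) \<partial>N)"
    by (intro nn_integral_liminf measurable_compose[OF cell_counts_measurable[OF \<eta>]]) simp
  also have "\<dots> \<le> liminf (\<lambda>L::nat. liminf (\<lambda>n. \<integral>\<^sup>+\<omega>. ennreal (b + F (\<xi> n \<omega>)) \<partial>M n))"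
    by (intro Liminf_mono always_eventually allI level)
  also have "\<dots> = liminf (\<lambda>n. \<integral>\<^sup>+\<omega>. ennreal (b + F (\<xi> n \<omega>)) \<partial>M n)"
    by (simp add: Liminf_const)
  finally have le: "ennreal (b + (\<integral>\<omega>. F (\<eta> \<omega>) \<partial>N)) \<le> liminf (\<lambda>n. ennreal (b + (\<integral>\<omega>. F (\<xi> n \<omega>) \<partial>M n)))"
    by (simp add: nn(1)[OF \<eta>] nn(1)[OF \<xi>])
  show ?thesis
  proof (cases "b + y < 0")
    case True
    then show ?thesis using nn(2)[OF \<xi>] by (intro always_eventually allI) (smt (verit))
  next
    case False
    then have "ennreal (b + y) < ennreal (b + (\<integral>\<omega>. F (\<eta> \<omega>) \<partial>N))"
      using y by (simp add: ennreal_less_iff)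
    then have "\<forall>\<^sub>F n in sequentially. ennreal (b + y) < ennreal (b + (\<integral>\<omega>. F (\<xi> n \<omega>) \<partial>M n))"
      using le unfolding le_Liminf_iff by blast
    then show ?thesis
      by eventually_elim (use False in \<open>simp add: ennreal_less_iff\<close>)
  qed
qed

theorem converges_vaguely_if_interval_counts_converge:
  fixes M :: "nat \<Rightarrow> 'a measure" and N :: "'b measure"
  assumes \<xi>: "\<And>n. point_process (M n) (\<xi> n)" and \<eta>: "point_process N \<eta>"
    and lim: "\<And>(I :: nat set) a b v. finite I \<Longrightarrow> disjoint_family_on (\<lambda>i. {a i<..b i}) I \<Longrightarrow>
        (\<And>i. i \<in> I \<Longrightarrow> 0 < a i \<and> a i < b i) \<Longrightarrow>
      (\<lambda>n. measure (M n) {\<omega> \<in> space (M n). \<forall>i\<in>I. emeasure (\<xi> n \<omega>) {a i<..b i} = of_nat (v i)})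
        \<longlonglongrightarrow> measure N {\<omega> \<in> space N. \<forall>i\<in>I. emeasure (\<eta> \<omega>) {a i<..b i} = of_nat (v i)}"
  shows "converges_vaguely_in_distribution M \<xi> N \<eta>"
proof -
  have counts: "(\<lambda>n. measure (M n) {\<omega> \<in> space (M n). cell_counts L (\<xi> n \<omega>) = v})
      \<longlonglongrightarrow> measure N {\<omega> \<in> space N. cell_counts L (\<eta> \<omega>) = v}" for L v
  proof (cases "length v = 4 ^ L - 1")
    case True
    have "(\<lambda>n. measure (M n) {\<omega> \<in> space (M n). \<forall>i\<in>cell_range L. emeasure (\<xi> n \<omega>) (cell L i) = of_nat (v ! (i - 1))})
        \<longlonglongrightarrow> measure N {\<omega> \<in> space N. \<forall>i\<in>cell_range L. emeasure (\<eta> \<omega>) (cell L i) = of_nat (v ! (i - 1))}"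
      unfolding cell_def by (rule lim)
        (use disjoint_cells[of L "cell_range L"] in \<open>auto simp: cell_def[abs_def] divide_strict_right_mono\<close>)
    then show ?thesis unfolding cell_counts_eq_event[OF \<xi>] cell_counts_eq_event[OF \<eta>] using True by simp
  next
    case False
    then show ?thesis unfolding cell_counts_eq_event[OF \<xi>] cell_counts_eq_event[OF \<eta>] by simp
  qed
  have "(\<lambda>n. \<integral>\<omega>. F (\<xi> n \<omega>) \<partial>M n) \<longlonglongrightarrow> (\<integral>\<omega>. F (\<eta> \<omega>) \<partial>N)"
    if F: "continuous_map vague_topology euclideanreal F" and bd: "bounded (F ` topspace vague_topology)" for F
  proof -
    obtain b where b: "\<And>\<nu>. \<nu> \<in> locally_finite_measures \<Longrightarrow> \<bar>F \<nu>\<bar> \<le> b"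
      using bd unfolding bounded_iff topspace_vague_topology by auto
    have b': "\<And>\<nu>. \<nu> \<in> locally_finite_measures \<Longrightarrow> \<bar>- F \<nu>\<bar> \<le> b" using b by simp
    have F': "continuous_map vague_topology euclideanreal (\<lambda>\<nu>. - F \<nu>)"
      using F by (rule continuous_map_minus)
    show ?thesis
    proof (rule order_tendstoI)
      fix y assume y: "y < (\<integral>\<omega>. F (\<eta> \<omega>) \<partial>N)"
      show "\<forall>\<^sub>F n in sequentially. y < (\<integral>\<omega>. F (\<xi> n \<omega>) \<partial>M n)"
        by (rule liminf_expectation_vaguely_continuous[OF \<xi> \<eta> counts F b y])
    next
      fix y assume "(\<integral>\<omega>. F (\<eta> \<omega>) \<partial>N) < y"
      then have y: "- y < (\<integral>\<omega>. - F (\<eta> \<omega>) \<partial>N)" by simp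
      have "\<forall>\<^sub>F n in sequentially. - y < (\<integral>\<omega>. - F (\<xi> n \<omega>) \<partial>M n)"
        by (rule liminf_expectation_vaguely_continuous[OF \<xi> \<eta> counts F' b' y])
      then show "\<forall>\<^sub>F n in sequentially. (\<integral>\<omega>. F (\<xi> n \<omega>) \<partial>M n) < y" by simp
    qed
  qed
  then show ?thesis
    using \<xi> \<eta> by (auto simp: converges_vaguely_in_distribution_def converges_in_distribution_def)
qed

section \<open>Integrals against point processes\<close>

lemma point_process_nn_integral_measurable:
  assumes \<xi>: "point_process M \<xi>" and f: "f \<in> borel_measurable pos_borel"
  shows "(\<lambda>\<omega>. \<integral>\<^sup>+t. f t \<partial>\<xi> \<omega>) \<in> borel_measurable M"
proof -
  have sets: "sets (\<xi> \<omega>) = sets pos_borel" and space: "space (\<xi> \<omega>) = {0<..}" if "\<omega> \<in> space M" for \<omega>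
    using point_process_locally_finite[OF \<xi> that]
    by (simp_all add: sets_locally_finite space_locally_finite)
  have meas: "g \<in> borel_measurable (\<xi> \<omega>)" if "g \<in> borel_measurable pos_borel" "\<omega> \<in> space M" for g :: "real \<Rightarrow> ennreal" and \<omega>
    using that(1) measurable_cong_sets[OF sets[OF that(2)] refl] by blast
  show ?thesis using f
  proof (induction rule: borel_measurable_induct)
    case (cong f g)
    have "(\<lambda>\<omega>. \<integral>\<^sup>+t. f t \<partial>\<xi> \<omega>) \<in> borel_measurable M \<longleftrightarrow> (\<lambda>\<omega>. \<integral>\<^sup>+t. g t \<partial>\<xi> \<omega>) \<in> borel_measurable M"
      by (intro measurable_cong nn_integral_cong) (use cong(3) space in auto)
    with cong show ?case by blast
  next
    case (set A)
    have "(\<lambda>\<omega>. emeasure (\<xi> \<omega>) A) \<in> borel_measurable M"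
      by (rule point_process_emeasure_measurable[OF \<xi> set])
    then show ?case
      by (rule measurable_cong[THEN iffD1, rotated]) (use set sets in auto)
  next
    case (mult u c)
    then have "(\<lambda>\<omega>. c * (\<integral>\<^sup>+t. u t \<partial>\<xi> \<omega>)) \<in> borel_measurable M" by simp
    then show ?case
      by (rule measurable_cong[THEN iffD1, rotated]) (use meas[OF mult(2)] in \<open>simp add: nn_integral_cmult\<close>)
  next
    case (add u v)
    then have "(\<lambda>\<omega>. (\<integral>\<^sup>+t. v t \<partial>\<xi> \<omega>) + (\<integral>\<^sup>+t. u t \<partial>\<xi> \<omega>)) \<in> borel_measurable M" by simp
    then show ?case
      by (rule measurable_cong[THEN iffD1, rotated])
         (intro nn_integral_add[symmetric] meas add)
  next
    case (seq U)
    then have "(\<lambda>\<omega>. SUP i. (\<integral>\<^sup>+t. U i t \<partial>\<xi> \<omega>)) \<in> borel_measurable M" by (intro borel_measurable_SUP) auto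
    then show ?case
      by (rule measurable_cong[THEN iffD1, rotated])
         (use meas[OF seq(1)] seq(3) in \<open>simp add: nn_integral_monotone_convergence_SUP image_comp\<close>)
  qed
qed

text \<open>Both sides are additive and continuous along increasing sequences in \<open>f\<close>, and they agree on
  indicator functions by hypothesis.\<close>

lemma campbell_formula:
  assumes \<xi>: "point_process M \<xi>" and \<Lambda>: "sets \<Lambda> = sets pos_borel"
    and mean: "\<And>B. B \<in> sets pos_borel \<Longrightarrow> (\<integral>\<^sup>+\<omega>. emeasure (\<xi> \<omega>) B \<partial>M) = emeasure \<Lambda> B"
    and f: "f \<in> borel_measurable pos_borel"
  shows "(\<integral>\<^sup>+\<omega>. \<integral>\<^sup>+t. f t \<partial>\<xi> \<omega> \<partial>M) = (\<integral>\<^sup>+t. f t \<partial>\<Lambda>)"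
proof -
  have sets: "sets (\<xi> \<omega>) = sets pos_borel" and space: "space (\<xi> \<omega>) = {0<..}" if "\<omega> \<in> space M" for \<omega>
    using point_process_locally_finite[OF \<xi> that]
    by (simp_all add: sets_locally_finite space_locally_finite)
  have meas: "g \<in> borel_measurable (\<xi> \<omega>)" if "g \<in> borel_measurable pos_borel" "\<omega> \<in> space M" for g :: "real \<Rightarrow> ennreal" and \<omega>
    using that(1) measurable_cong_sets[OF sets[OF that(2)] refl] by blast
  have meas_\<Lambda>: "g \<in> borel_measurable \<Lambda>" if "g \<in> borel_measurable pos_borel" for g :: "real \<Rightarrow> ennreal"
    using that measurable_cong_sets[OF \<Lambda> refl] by blast
  note meas_M = point_process_nn_integral_measurable[OF \<xi>]
  show ?thesis using f
  proof (induction rule: borel_measurable_induct)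
    case (cong f g)
    have "(\<integral>\<^sup>+\<omega>. \<integral>\<^sup>+t. f t \<partial>\<xi> \<omega> \<partial>M) = (\<integral>\<^sup>+\<omega>. \<integral>\<^sup>+t. g t \<partial>\<xi> \<omega> \<partial>M)"
      by (intro nn_integral_cong) (use cong(3) space in auto)
    moreover have "(\<integral>\<^sup>+t. f t \<partial>\<Lambda>) = (\<integral>\<^sup>+t. g t \<partial>\<Lambda>)"
      by (intro nn_integral_cong) (use cong(3) sets_eq_imp_space_eq[OF \<Lambda>] in auto)
    ultimately show ?case using cong by simp
  next
    case (set A)
    have "(\<integral>\<^sup>+\<omega>. \<integral>\<^sup>+t. indicator A t \<partial>\<xi> \<omega> \<partial>M) = (\<integral>\<^sup>+\<omega>. emeasure (\<xi> \<omega>) A \<partial>M)"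
      by (intro nn_integral_cong nn_integral_indicator) (use set sets in auto)
    then show ?case using mean[OF set] set \<Lambda> by simp
  next
    case (mult u c)
    have "(\<integral>\<^sup>+\<omega>. \<integral>\<^sup>+t. c * u t \<partial>\<xi> \<omega> \<partial>M) = (\<integral>\<^sup>+\<omega>. c * (\<integral>\<^sup>+t. u t \<partial>\<xi> \<omega>) \<partial>M)"
      by (intro nn_integral_cong nn_integral_cmult meas[OF mult(2)])
    then show ?case using mult by (simp add: nn_integral_cmult meas_M meas_\<Lambda>)
  next
    case (add u v)
    have "(\<integral>\<^sup>+\<omega>. \<integral>\<^sup>+t. v t + u t \<partial>\<xi> \<omega> \<partial>M) = (\<integral>\<^sup>+\<omega>. (\<integral>\<^sup>+t. v t \<partial>\<xi> \<omega>) + (\<integral>\<^sup>+t. u t \<partial>\<xi> \<omega>) \<partial>M)"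
      by (intro nn_integral_cong nn_integral_add meas add)
    then show ?case using add by (simp add: nn_integral_add meas_M meas_\<Lambda>)
  next
    case (seq U)
    have "(\<integral>\<^sup>+\<omega>. \<integral>\<^sup>+t. (SUP i. U i t) \<partial>\<xi> \<omega> \<partial>M) = (\<integral>\<^sup>+\<omega>. (SUP i. (\<integral>\<^sup>+t. U i t \<partial>\<xi> \<omega>)) \<partial>M)"
      by (intro nn_integral_cong nn_integral_monotone_convergence_SUP meas seq)
    also have "\<dots> = (SUP i. (\<integral>\<^sup>+\<omega>. \<integral>\<^sup>+t. U i t \<partial>\<xi> \<omega> \<partial>M))"
      using seq(3) by (intro nn_integral_monotone_convergence_SUP meas_M seq)
        (auto simp: incseq_def le_fun_def intro!: nn_integral_mono)
    also have "\<dots> = (SUP i. (\<integral>\<^sup>+t. U i t \<partial>\<Lambda>))" using seq by simp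
    also have "\<dots> = (\<integral>\<^sup>+t. (SUP i. U i t) \<partial>\<Lambda>)"
      by (intro nn_integral_monotone_convergence_SUP[symmetric] meas_\<Lambda> seq)
    finally show ?case by (simp add: image_comp)
  qed
qed

definition poisson_mass :: "real \<Rightarrow> nat \<Rightarrow> real" where
  "poisson_mass r k = r ^ k / fact k * exp (- r)"

lemma poisson_mass_nonneg: "0 \<le> r \<Longrightarrow> 0 \<le> poisson_mass r k"
  by (simp add: poisson_mass_def)

lemma poisson_mass_sums: "poisson_mass r sums 1"
proof -
  have "(\<lambda>k. r ^ k / fact k * exp (- r)) sums (exp r * exp (- r))"
    using exp_converges[of r] by (intro sums_mult2) (simp add: field_simps)
  then show ?thesis by (simp add: poisson_mass_def[abs_def] exp_minus)
qed

lemma poisson_mean_sums: "(\<lambda>k. real k * poisson_mass r k) sums r"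
proof -
  have "(\<lambda>k. real (Suc k) * poisson_mass r (Suc k)) = (\<lambda>k. r * poisson_mass r k)"
    by (rule ext) (simp add: poisson_mass_def field_simps del: of_nat_Suc)
  then have "(\<lambda>k. real (Suc k) * poisson_mass r (Suc k)) sums (r * 1)"
    using sums_mult[OF poisson_mass_sums] by simp
  then show ?thesis by (subst (asm) sums_Suc_iff) simp
qed

text \<open>When \<open>\<Lambda> B\<close> is finite, the probabilities of the finite counts sum to 1. This excludes an infinite
  count almost surely, so the mean is the one of the Poisson distribution.\<close>

lemma poisson_process_mean:
  assumes \<eta>: "poisson_process N \<Lambda> \<eta>" and B: "B \<in> sets pos_borel"
  shows "(\<integral>\<^sup>+\<omega>. emeasure (\<eta> \<omega>) B \<partial>N) = emeasure \<Lambda> B"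
proof -
  have pp: "point_process N \<eta>" using \<eta> by (simp add: poisson_process_def)
  interpret N: prob_space N using pp by (simp add: point_process_def)
  have [measurable]: "(\<lambda>\<omega>. emeasure (\<eta> \<omega>) B) \<in> borel_measurable N"
    by (rule point_process_emeasure_measurable[OF pp B])
  show ?thesis
  proof (cases "emeasure \<Lambda> B < \<infinity>")
    case False
    then have inf: "emeasure \<Lambda> B = \<infinity>" by (simp add: less_top[symmetric])
    then have "AE \<omega> in N. emeasure (\<eta> \<omega>) B = \<infinity>"
      using \<eta> B by (auto simp: poisson_process_def)
    then have "(\<integral>\<^sup>+\<omega>. emeasure (\<eta> \<omega>) B \<partial>N) = (\<integral>\<^sup>+\<omega>. \<infinity> \<partial>N)" by (rule nn_integral_cong_AE)
    then show ?thesis using inf by (simp add: N.emeasure_space_1)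
  next
    case True
    define r where "r = measure \<Lambda> B"
    have r: "emeasure \<Lambda> B = ennreal r" "0 \<le> r"
      using True by (simp_all add: r_def emeasure_eq_ennreal_measure)
    define E where "E k = {\<omega> \<in> space N. emeasure (\<eta> \<omega>) B = of_nat k}" for k
    have E [measurable]: "E k \<in> sets N" for k unfolding E_def by measurable
    have pE: "measure N (E k) = poisson_mass r k" for k
      using \<eta> B True by (auto simp: poisson_process_def E_def poisson_mass_def r_def)
    have "disjoint_family E" by (auto simp: disjoint_family_on_def E_def)
    then have "(\<lambda>k. measure N (E k)) sums measure N (\<Union>k. E k)"
      using E by (intro N.finite_measure_UNION) auto
    then have "measure N (\<Union>k. E k) = 1"
      unfolding pE using poisson_mass_sums sums_unique2 by blast
    then have fin: "AE \<omega> in N. \<omega> \<in> (\<Union>k. E k)"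
      using E by (intro N.AE_prob_1) auto
    define V where "V \<omega> = nat \<lfloor>enn2real (emeasure (\<eta> \<omega>) B)\<rfloor>" for \<omega>
    have [measurable]: "V \<in> measurable N (count_space UNIV)"
      unfolding V_def by measurable
    have EV: "emeasure N {\<omega> \<in> space N. V \<omega> = k} = ennreal (poisson_mass r k)" for k
    proof -
      have "AE \<omega> in N. \<omega> \<in> {\<omega> \<in> space N. V \<omega> = k} \<longleftrightarrow> \<omega> \<in> E k"
        using fin AE_space by eventually_elim (auto simp: V_def E_def)
      then have "emeasure N {\<omega> \<in> space N. V \<omega> = k} = emeasure N (E k)"
        by (rule emeasure_eq_AE) auto
      then show ?thesis by (simp add: N.emeasure_eq_measure pE)
    qed
    have "AE \<omega> in N. emeasure (\<eta> \<omega>) B = of_nat (V \<omega>)"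
      using fin by eventually_elim (auto simp: V_def E_def)
    then have "(\<integral>\<^sup>+\<omega>. emeasure (\<eta> \<omega>) B \<partial>N) = (\<integral>\<^sup>+\<omega>. of_nat (V \<omega>) \<partial>N)"
      by (rule nn_integral_cong_AE)
    also have "\<dots> = (\<integral>\<^sup>+k. of_nat k * ennreal (poisson_mass r k) \<partial>count_space UNIV)"
      by (subst nn_integral_countable_valued) (simp_all add: EV)
    also have "\<dots> = (\<Sum>k. ennreal (real k * poisson_mass r k))"
      by (simp add: nn_integral_count_space_nat ennreal_mult poisson_mass_nonneg r ennreal_of_nat_eq_real_of_nat)
    also have "\<dots> = ennreal r"
      by (intro suminf_ennreal_eq poisson_mean_sums) (simp add: poisson_mass_nonneg r)
    finally show ?thesis by (simp add: r)
  qed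
qed

section \<open>Poisson approximation of sums of independent counts\<close>

lemma poisson_mass_convolution:
  "(\<Sum>j\<le>m. poisson_mass r j * poisson_mass s (m - j)) = poisson_mass (r + s) m"
proof -
  have exp_neg_add: "exp (- r - s) = exp (- r) * exp (- s)" by (simp flip: exp_add)
  have "poisson_mass (r + s) m = (\<Sum>j\<le>m. of_nat (m choose j) * r ^ j * s ^ (m - j)) / fact m * exp (- (r + s))"
    by (simp add: poisson_mass_def binomial_ring)
  also have "\<dots> = (\<Sum>j\<le>m. of_nat (m choose j) * r ^ j * s ^ (m - j) / fact m * exp (- (r + s)))"
    by (simp only: sum_divide_distrib sum_distrib_right)
  also have "\<dots> = (\<Sum>j\<le>m. poisson_mass r j * poisson_mass s (m - j))"
    by (intro sum.cong refl) (simp add: poisson_mass_def binomial_fact exp_neg_add field_simps)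
  finally show ?thesis ..
qed

lemma poisson_mass_partial_sum_le: "0 \<le> r \<Longrightarrow> (\<Sum>j\<le>m. poisson_mass r j) \<le> 1"
  using sum_le_suminf[of "poisson_mass r" "{..m}"] poisson_mass_sums[of r]
  by (simp add: poisson_mass_nonneg sums_iff)

lemma (in prob_space) prob_partial_sum:
  fixes X :: "'a \<Rightarrow> nat"
  assumes [measurable]: "X \<in> measurable M (count_space UNIV)"
  shows "(\<Sum>j\<le>m. prob {\<omega> \<in> space M. X \<omega> = j}) = prob {\<omega> \<in> space M. X \<omega> \<le> m}"
proof -
  have "{\<omega> \<in> space M. X \<omega> \<le> m} = (\<Union>j\<in>{..m}. {\<omega> \<in> space M. X \<omega> = j})" by auto
  then show ?thesis
    by (simp only:) (subst finite_measure_finite_Union, auto simp: disjoint_family_on_def)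
qed

lemma (in prob_space) prob_sum_insert:
  fixes X :: "'i \<Rightarrow> 'a \<Rightarrow> nat"
  assumes indep: "indep_vars (\<lambda>_. count_space UNIV) X (insert k J)" and J: "finite J" "k \<notin> J"
  shows "prob {\<omega> \<in> space M. (\<Sum>i\<in>insert k J. X i \<omega>) = m}
    = (\<Sum>j\<le>m. prob {\<omega> \<in> space M. (\<Sum>i\<in>J. X i \<omega>) = j} * prob {\<omega> \<in> space M. X k \<omega> = m - j})"
proof -
  have [measurable]: "X i \<in> measurable M (count_space UNIV)" if "i \<in> insert k J" for i
    using indep that unfolding indep_vars_def2 by blast
  have S: "(\<lambda>\<omega>. \<Sum>i\<in>J. X i \<omega>) \<in> measurable M (count_space UNIV)" by measurable
  have "indep_var
      (count_space UNIV) ((\<lambda>f. \<Sum>i\<in>J. f i) \<circ> (\<lambda>\<omega>. restrict (\<lambda>i. X i \<omega>) J))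
      (count_space UNIV) ((\<lambda>f. f k) \<circ> (\<lambda>\<omega>. restrict (\<lambda>i. X i \<omega>) {k}))"
    using J by (intro indep_var_compose[OF indep_var_restrict[OF indep]]) auto
  then have iv: "indep_var (count_space UNIV) (\<lambda>\<omega>. \<Sum>i\<in>J. X i \<omega>) (count_space UNIV) (X k)"
    by (simp add: comp_def)
  have pr: "prob {\<omega> \<in> space M. (\<Sum>i\<in>J. X i \<omega>) = j \<and> X k \<omega> = l}
      = prob {\<omega> \<in> space M. (\<Sum>i\<in>J. X i \<omega>) = j} * prob {\<omega> \<in> space M. X k \<omega> = l}" for j l
    using indep_varD[OF iv, of "{j}" "{l}"] by (simp add: vimage_def Int_def conj_commute conj_left_commute)
  have "{\<omega> \<in> space M. (\<Sum>i\<in>insert k J. X i \<omega>) = m}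
      = (\<Union>j\<in>{..m}. {\<omega> \<in> space M. (\<Sum>i\<in>J. X i \<omega>) = j \<and> X k \<omega> = m - j})"
    using J by auto
  moreover have "{\<omega> \<in> space M. (\<Sum>i\<in>J. X i \<omega>) = j \<and> X k \<omega> = l} \<in> sets M" for j l
    using S by measurable
  ultimately have "prob {\<omega> \<in> space M. (\<Sum>i\<in>insert k J. X i \<omega>) = m}
      = (\<Sum>j\<le>m. prob {\<omega> \<in> space M. (\<Sum>i\<in>J. X i \<omega>) = j \<and> X k \<omega> = m - j})"
    by (simp only:) (subst finite_measure_finite_Union, auto simp: disjoint_family_on_def)
  then show ?thesis by (simp add: pr)
qed

text \<open>Replacing one summand at a time by a Poisson variable: the laws of partial sums are convolutions,
  and convolving with a probability mass function does not increase the uniform distance. Only the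
  error of each single summand has to be measured in total variation.\<close>

lemma (in prob_space) poisson_approximation:
  fixes X :: "'i \<Rightarrow> 'a \<Rightarrow> nat" and r d :: "'i \<Rightarrow> real"
  assumes "finite J" and "indep_vars (\<lambda>_. count_space UNIV) X J"
    and "\<And>k. k \<in> J \<Longrightarrow> 0 \<le> r k"
    and "\<And>k m. k \<in> J \<Longrightarrow> (\<Sum>j\<le>m. \<bar>prob {\<omega> \<in> space M. X k \<omega> = j} - poisson_mass (r k) j\<bar>) \<le> d k"
  shows "\<bar>prob {\<omega> \<in> space M. (\<Sum>k\<in>J. X k \<omega>) = m} - poisson_mass (\<Sum>k\<in>J. r k) m\<bar> \<le> (\<Sum>k\<in>J. d k)"
  using assms
proof (induction arbitrary: m)
  case empty
  have "{\<omega> \<in> space M. 0 = m} = (if m = 0 then space M else {})" by auto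
  then show ?case by (cases "m = 0") (auto simp: prob_space poisson_mass_def zero_power)
next
  case (insert k J)
  note ind = insert.prems(1)
  define S where "S j = prob {\<omega> \<in> space M. (\<Sum>i\<in>J. X i \<omega>) = j}" for j
  define P where "P j = poisson_mass (\<Sum>i\<in>J. r i) j" for j
  define x where "x j = prob {\<omega> \<in> space M. X k \<omega> = j}" for j
  define p where "p j = poisson_mass (r k) j" for j
  have IH: "\<bar>S j - P j\<bar> \<le> (\<Sum>i\<in>J. d i)" for j
    unfolding S_def P_def using insert.prems indep_vars_subset[OF ind] by (intro insert.IH) auto
  have mk [measurable]: "X k \<in> measurable M (count_space UNIV)"
    using ind by (simp add: indep_vars_def2)
  have x0: "0 \<le> x j" for j by (simp add: x_def)
  have x1: "(\<Sum>j\<le>m. x j) \<le> 1" unfolding x_def prob_partial_sum[OF mk] by simp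
  have R: "0 \<le> (\<Sum>i\<in>J. r i)" using insert.prems(2) by (intro sum_nonneg) auto
  have P01: "0 \<le> P j" "P j \<le> 1" for j
  proof -
    show "0 \<le> P j" for j using R by (simp add: P_def poisson_mass_nonneg)
    have "P j \<le> (\<Sum>i\<le>j. P i)" using R by (intro member_le_sum) (auto simp: P_def poisson_mass_nonneg)
    also have "\<dots> \<le> 1" unfolding P_def by (rule poisson_mass_partial_sum_le[OF R])
    finally show "P j \<le> 1" .
  qed
  have D: "0 \<le> (\<Sum>i\<in>J. d i)" using IH[of 0] by linarith
  have flip: "(\<Sum>j\<le>m. f (m - j)) = (\<Sum>j\<le>m. f j)" for f :: "nat \<Rightarrow> real"
    using sum.nat_diff_reindex[of f "Suc m"] by (simp add: lessThan_Suc_atMost)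
  have "prob {\<omega> \<in> space M. (\<Sum>i\<in>insert k J. X i \<omega>) = m} - poisson_mass (\<Sum>i\<in>insert k J. r i) m
      = (\<Sum>j\<le>m. S j * x (m - j)) - (\<Sum>j\<le>m. P j * p (m - j))"
    using prob_sum_insert[OF ind insert.hyps, of m] insert.hyps
      poisson_mass_convolution[of "\<Sum>i\<in>J. r i" "r k" m]
    by (simp add: S_def P_def x_def p_def add.commute)
  \<comment> \<open>Exchange the factors of the convolution one after the other: \<open>S x - P p = (S - P) x + P (x - p)\<close>.\<close>
  also have "\<dots> = (\<Sum>j\<le>m. (S j - P j) * x (m - j)) + (\<Sum>j\<le>m. P j * (x (m - j) - p (m - j)))"
    unfolding sum_subtractf[symmetric] sum.distrib[symmetric] by (intro sum.cong) (auto simp: algebra_simps)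
  also have "\<bar>\<dots>\<bar> \<le> (\<Sum>j\<le>m. \<bar>(S j - P j) * x (m - j)\<bar>) + (\<Sum>j\<le>m. \<bar>P j * (x (m - j) - p (m - j))\<bar>)"
    by (intro order_trans[OF abs_triangle_ineq] add_mono sum_abs)
  also have "\<dots> \<le> (\<Sum>j\<le>m. (\<Sum>i\<in>J. d i) * x (m - j)) + (\<Sum>j\<le>m. 1 * \<bar>x (m - j) - p (m - j)\<bar>)"
    unfolding abs_mult using IH x0 P01 D by (intro add_mono sum_mono mult_mono) auto
  also have "\<dots> = (\<Sum>i\<in>J. d i) * (\<Sum>j\<le>m. x j) + (\<Sum>j\<le>m. \<bar>x j - p j\<bar>)"
    using flip[of x] flip[of "\<lambda>j. \<bar>x j - p j\<bar>"] by (simp flip: sum_distrib_left)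
  also have "\<dots> \<le> (\<Sum>i\<in>J. d i) * 1 + d k"
    using D x1 insert.prems(3)[of k m] by (intro add_mono mult_left_mono) (auto simp: x_def p_def)
  finally show ?case using insert.hyps by simp
qed

lemma sum_abs_diff_le_tails:
  fixes p q :: "nat \<Rightarrow> real"
  assumes "\<And>j. 0 \<le> p j" "\<And>j. 0 \<le> q j" "\<And>m. (\<Sum>j\<le>m. p j) \<le> 1" "\<And>m. (\<Sum>j\<le>m. q j) \<le> 1"
  shows "(\<Sum>j\<le>m. \<bar>p j - q j\<bar>) \<le> \<bar>p 0 - q 0\<bar> + \<bar>p 1 - q 1\<bar> + (1 - p 0 - p 1) + (1 - q 0 - q 1)"
proof -
  have split: "(\<Sum>j\<le>Suc (Suc m). f j) = f 0 + f 1 + (\<Sum>j\<le>m. f (Suc (Suc j)))" for f :: "nat \<Rightarrow> real"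
    by (simp only: sum.atMost_Suc_shift One_nat_def add.assoc)
  have "(\<Sum>j\<le>m. \<bar>p j - q j\<bar>) \<le> (\<Sum>j\<le>Suc (Suc m). \<bar>p j - q j\<bar>)" by (intro sum_mono2) auto
  also have "\<dots> = \<bar>p 0 - q 0\<bar> + \<bar>p 1 - q 1\<bar> + (\<Sum>j\<le>m. \<bar>p (Suc (Suc j)) - q (Suc (Suc j))\<bar>)"
    by (rule split)
  also have "(\<Sum>j\<le>m. \<bar>p (Suc (Suc j)) - q (Suc (Suc j))\<bar>) \<le> (\<Sum>j\<le>m. p (Suc (Suc j)) + q (Suc (Suc j)))"
    using assms(1,2) by (intro sum_mono) (smt (verit))
  also have "\<dots> = (\<Sum>j\<le>m. p (Suc (Suc j))) + (\<Sum>j\<le>m. q (Suc (Suc j)))" by (rule sum.distrib)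
  finally show ?thesis
    using assms(3)[of "Suc (Suc m)"] assms(4)[of "Suc (Suc m)"] unfolding split[of p] split[of q] by linarith
qed

text \<open>The two laws agree at 0, differ by \<open>O(r\<^sup>2)\<close> at 1, and both give mass \<open>O(r\<^sup>2)\<close> to the values from 2
  on. The hypothesis on \<open>P(X = 1)\<close> is exactly what makes the mass of these values the square of
  \<open>1 - exp (- r)\<close>.\<close>

lemma (in prob_space) distance_to_poisson_le:
  fixes X :: "'a \<Rightarrow> nat"
  assumes X: "X \<in> measurable M (count_space UNIV)" and r: "0 \<le> r"
    and p0: "prob {\<omega> \<in> space M. X \<omega> = 0} = exp (- r)"
    and p1: "prob {\<omega> \<in> space M. X \<omega> = 1} = exp (- r) * (1 - exp (- r))"
  shows "(\<Sum>j\<le>m. \<bar>prob {\<omega> \<in> space M. X \<omega> = j} - poisson_mass r j\<bar>) \<le> 3 * r\<^sup>2"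
proof -
  define u where "u = exp (- r)"
  have u: "1 - r \<le> u" "u \<le> 1" "0 < u" using exp_ge_add_one_self[of "- r"] r by (auto simp: u_def)
  have "u \<le> 1 / (1 + r)"
    using exp_ge_add_one_self[of r] r by (auto simp: u_def exp_minus inverse_eq_divide intro!: divide_left_mono)
  also have "\<dots> \<le> 1 - r + r\<^sup>2"
  proof -
    have "(1 - r + r\<^sup>2) * (1 + r) = 1 + r ^ 3" by (simp add: power2_eq_square power3_eq_cube algebra_simps)
    then show ?thesis using r by (simp add: divide_le_eq)
  qed
  finally have u2: "u \<le> 1 - r + r\<^sup>2" .
  have "u * (1 - u) - u * r = - (u * (u - (1 - r)))" by (simp add: algebra_simps)
  then have "\<bar>u * (1 - u) - u * r\<bar> = u * (u - (1 - r))"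
    using u by (simp only: abs_minus abs_of_nonneg mult_nonneg_nonneg diff_ge_0_iff_ge less_imp_le)
  also have "\<dots> \<le> 1 * r\<^sup>2" using u u2 by (intro mult_mono) auto
  finally have t1: "\<bar>u * (1 - u) - u * r\<bar> \<le> r\<^sup>2" by simp
  have "(1 - u)\<^sup>2 \<le> r\<^sup>2" using u by (intro power_mono) auto
  then have t2: "1 - u - u * (1 - u) \<le> r\<^sup>2" by (simp add: power2_eq_square algebra_simps)
  have "(1 - r) * (1 + r) \<le> u * (1 + r)" using u r by (intro mult_right_mono) auto
  then have t3: "1 - u - u * r \<le> r\<^sup>2" by (simp add: power2_eq_square algebra_simps)
  have q: "poisson_mass r 0 = u" "poisson_mass r 1 = u * r" by (auto simp: poisson_mass_def u_def)
  have "(\<Sum>j\<le>m. \<bar>prob {\<omega> \<in> space M. X \<omega> = j} - poisson_mass r j\<bar>)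
      \<le> \<bar>u - u\<bar> + \<bar>u * (1 - u) - u * r\<bar> + (1 - u - u * (1 - u)) + (1 - u - u * r)"
    using sum_abs_diff_le_tails[of "\<lambda>j. prob {\<omega> \<in> space M. X \<omega> = j}" "poisson_mass r" m]
    unfolding p0 p1 q u_def[symmetric]
    by (simp add: poisson_mass_nonneg[OF r] poisson_mass_partial_sum_le[OF r] prob_partial_sum[OF X])
  then show ?thesis using t1 t2 t3 by linarith
qed

section \<open>Slowly growing sequences\<close>

lemma sum_increments:
  fixes f :: "nat \<Rightarrow> real"
  assumes "l \<le> r" shows "(\<Sum>k\<in>{l<..r}. f k - f (k - 1)) = f r - f l"
  using assms
proof (induction rule: dec_induct)
  case (step r)
  have "{l<..Suc r} = insert (Suc r) {l<..r}" using step by auto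
  then show ?case using step by simp
qed simp

locale slowly_growing =
  fixes z :: "nat \<Rightarrow> real"
  assumes z_pos: "z k > 0" and z_mono: "mono z" and z_at_top: "filterlim z at_top sequentially"
    and z_ratio: "(\<lambda>k. z (Suc k) / z k) \<longlonglongrightarrow> 1"
begin

definition last_below :: "real \<Rightarrow> nat" where
  "last_below y = Max {k. z k \<le> y}"

lemma le_iff_le_last_below:
  assumes "z 0 \<le> y"
  shows "z k \<le> y \<longleftrightarrow> k \<le> last_below y"
proof -
  obtain K where K: "\<And>k. K \<le> k \<Longrightarrow> y < z k"
    using z_at_top unfolding filterlim_at_top_dense eventually_sequentially by metis
  have fin: "finite {k. z k \<le> y}"
    by (rule finite_subset[of _ "{..K}"]) (use K in \<open>auto simp: not_less[symmetric] intro: ccontr dest: less_imp_le\<close>)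
  have mem: "z (last_below y) \<le> y"
    using Max_in[OF fin] assms unfolding last_below_def by auto
  show ?thesis
  proof
    show "k \<le> last_below y" if "z k \<le> y"
      unfolding last_below_def using fin that by (intro Max_ge) auto
    show "z k \<le> y" if "k \<le> last_below y"
      using monoD[OF z_mono that] mem by simp
  qed
qed

lemma last_below_at_top: "filterlim last_below at_top at_top"
  unfolding filterlim_at_top
proof
  fix K
  show "\<forall>\<^sub>F y in at_top. K \<le> last_below y"
    using eventually_ge_at_top[of "z K"]
  proof eventually_elim
    case (elim y)
    then have "z 0 \<le> y" using monoD[OF z_mono, of 0 K] by simp
    then show ?case using le_iff_le_last_below elim by blast
  qed
qed

text \<open>By definition \<open>z l \<le> y < z (l + 1)\<close> for \<open>l = last_below y\<close>, and the two bounds are asymptotically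
  equal.\<close>

lemma last_below_asymp: "((\<lambda>y. z (last_below y) / y) \<longlongrightarrow> 1) at_top"
proof (rule tendsto_sandwich)
  have "(\<lambda>k. inverse (z (Suc k) / z k)) \<longlonglongrightarrow> inverse 1"
    by (intro tendsto_inverse z_ratio) simp
  then have "(\<lambda>k. z k / z (Suc k)) \<longlonglongrightarrow> 1" by simp
  then show "((\<lambda>y. z (last_below y) / z (Suc (last_below y))) \<longlongrightarrow> 1) at_top"
    by (rule filterlim_compose[OF _ last_below_at_top])
  show "\<forall>\<^sub>F y in at_top. z (last_below y) / z (Suc (last_below y)) \<le> z (last_below y) / y"
    using eventually_ge_at_top[of "z 0"]
  proof eventually_elim
    case (elim y)
    have "y < z (Suc (last_below y))" using le_iff_le_last_below[OF elim, of "Suc (last_below y)"] by simp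
    then show ?case using elim z_pos[of 0] z_pos[of "last_below y"] by (intro divide_left_mono) auto
  qed
  show "\<forall>\<^sub>F y in at_top. z (last_below y) / y \<le> 1"
    using eventually_ge_at_top[of "z 0"]
  proof eventually_elim
    case (elim y)
    have "z (last_below y) \<le> y" using le_iff_le_last_below[OF elim] by simp
    then show ?case using elim z_pos[of 0] by simp
  qed
qed simp

lemma scaled_at_top: "0 < a \<Longrightarrow> filterlim (\<lambda>n. a * z n) at_top sequentially"
  by (rule filterlim_tendsto_pos_mult_at_top[OF tendsto_const _ z_at_top])

lemma last_below_scaled_at_top: "0 < a \<Longrightarrow> filterlim (\<lambda>n. last_below (a * z n)) at_top sequentially"
  by (rule filterlim_compose[OF last_below_at_top scaled_at_top])

lemma last_below_scaled_asymp:
  assumes a: "0 < a"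
  shows "(\<lambda>n. z (last_below (a * z n)) / z n) \<longlonglongrightarrow> a"
proof -
  have "(\<lambda>n. a * (z (last_below (a * z n)) / (a * z n))) \<longlonglongrightarrow> a * 1"
    by (intro tendsto_mult tendsto_const filterlim_compose[OF last_below_asymp scaled_at_top[OF a]])
  then show ?thesis using a by simp
qed

lemma eventually_scaled_ge: "0 < a \<Longrightarrow> \<forall>\<^sub>F n in sequentially. z 0 \<le> a * z n"
  using scaled_at_top[of a] by (simp add: filterlim_at_top)

text \<open>The indices of the points that lie in \<open>(a, b]\<close> after rescaling by \<open>z n\<close>. They start at 1, like
  the points of the process.\<close>

definition window :: "nat \<Rightarrow> real \<Rightarrow> real \<Rightarrow> nat set" where
  "window n a b = {k. 1 \<le> k \<and> a < z k / z n \<and> z k / z n \<le> b}"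

lemma window_subset: "window n a b \<subseteq> {1..}"
  by (auto simp: window_def)

lemma finite_window: "finite (window n a b)"
proof -
  obtain K where K: "\<And>k. K \<le> k \<Longrightarrow> b * z n < z k"
    using z_at_top unfolding filterlim_at_top_dense eventually_sequentially by metis
  have "window n a b \<subseteq> {..K}"
  proof
    fix k assume "k \<in> window n a b"
    then have "\<not> b * z n < z k" using z_pos[of n] by (simp add: window_def divide_le_eq)
    then show "k \<in> {..K}" using K[of k] by force
  qed
  then show ?thesis by (rule finite_subset) simp
qed

lemma disjoint_windows:
  assumes "disjoint_family_on (\<lambda>i. {a i<..b i}) I"
  shows "disjoint_family_on (\<lambda>i. window n (a i) (b i)) I"
proof -
  have "window n a b = {1..} \<inter> (\<lambda>k. z k / z n) -` {a<..b}" for a b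
    by (auto simp: window_def)
  then show ?thesis using assms unfolding disjoint_family_on_def by blast
qed

lemma window_eq:
  assumes "z 0 \<le> a * z n" "a \<le> b"
  shows "window n a b = {last_below (a * z n)<..last_below (b * z n)}"
proof -
  have b: "z 0 \<le> b * z n"
    using assms z_pos[of n] by (intro order_trans[OF assms(1)] mult_right_mono) auto
  have "a < z k / z n \<longleftrightarrow> last_below (a * z n) < k" "z k / z n \<le> b \<longleftrightarrow> k \<le> last_below (b * z n)" for k
    using le_iff_le_last_below[OF assms(1), of k] le_iff_le_last_below[OF b, of k] z_pos[of n]
    by (auto simp: less_divide_eq divide_le_eq)
  then show ?thesis by (auto simp: window_def)
qed

lemma last_below_mono:
  assumes "z 0 \<le> x" "x \<le> y"
  shows "last_below x \<le> last_below y"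
proof -
  have "z (last_below x) \<le> y" using le_iff_le_last_below[OF assms(1)] assms(2) by (blast intro: order_trans)
  then show ?thesis using le_iff_le_last_below[of y] assms by auto
qed

definition log_step :: "nat \<Rightarrow> real" where
  "log_step k = ln (z k) - ln (z (k - 1))"

lemma log_step_nonneg: "0 \<le> log_step k"
  using monoD[OF z_mono, of "k - 1" k] z_pos by (simp add: log_step_def)

lemma log_step_tendsto: "log_step \<longlonglongrightarrow> 0"
proof -
  have "(\<lambda>k. ln (z (Suc k) / z k)) \<longlonglongrightarrow> ln 1"
    by (intro tendsto_ln z_ratio) simp
  then have "(\<lambda>k. log_step (Suc k)) \<longlonglongrightarrow> 0"
    using z_pos by (simp add: log_step_def ln_div less_imp_neq[symmetric])
  then show ?thesis by (rule LIMSEQ_imp_Suc)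
qed

lemma sum_log_step_tendsto:
  assumes a: "0 < a" "a \<le> b"
  shows "(\<lambda>n. \<Sum>k\<in>window n a b. log_step k) \<longlonglongrightarrow> ln (b / a)"
proof -
  have b: "0 < b" using a by simp
  have "(\<lambda>n. ln (z (last_below (b * z n)) / z n) - ln (z (last_below (a * z n)) / z n)) \<longlonglongrightarrow> ln b - ln a"
    using a b by (intro tendsto_diff tendsto_ln last_below_scaled_asymp) auto
  moreover have "\<forall>\<^sub>F n in sequentially.
      ln (z (last_below (b * z n)) / z n) - ln (z (last_below (a * z n)) / z n) = (\<Sum>k\<in>window n a b. log_step k)"
    using eventually_scaled_ge[OF a(1)]
  proof eventually_elim
    case (elim n)
    have "last_below (a * z n) \<le> last_below (b * z n)"
      using elim a z_pos[of n] by (intro last_below_mono) auto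
    from sum_increments[OF this, of "\<lambda>k. ln (z k)"] show ?case
      unfolding window_eq[OF elim a(2)] log_step_def
      using z_pos by (simp add: ln_div less_imp_neq[symmetric])
  qed
  ultimately have "(\<lambda>n. \<Sum>k\<in>window n a b. log_step k) \<longlonglongrightarrow> ln b - ln a"
    by (rule Lim_transform_eventually)
  then show ?thesis using a b by (simp add: ln_div)
qed

text \<open>The sum of squares is at most the largest step times the sum of the steps. The latter converges,
  and the former vanishes because the window moves off to infinity.\<close>

lemma sum_log_step_squared_tendsto:
  assumes a: "0 < a" "a \<le> b"
  shows "(\<lambda>n. \<Sum>k\<in>window n a b. (log_step k)\<^sup>2) \<longlonglongrightarrow> 0"
proof (rule tendsto_sandwich[of "\<lambda>_. 0"])
  \<comment> \<open>The supremum over all later steps is an upper bound for the window that depends on its left end only.\<close>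
  define m where "m l = (SUP k\<in>{l<..}. log_step k)" for l
  have bdd: "bdd_above (range log_step)"
    using convergent_imp_Bseq[OF convergentI[OF log_step_tendsto]] by (rule Bseq_bdd_above)
  have m_ge: "log_step k \<le> m l" if "l < k" for l k
    unfolding m_def using that by (intro cSUP_upper bdd_above_mono[OF bdd]) auto
  have m0: "0 \<le> m l" for l using m_ge[of l "Suc l"] log_step_nonneg[of "Suc l"] by simp
  have "m \<longlonglongrightarrow> 0"
  proof (rule order_tendstoI)
    show "\<forall>\<^sub>F l in sequentially. y < m l" if "y < 0" for y
      using that m0 by (intro always_eventually allI) (rule less_le_trans)
  next
    fix y :: real assume y: "0 < y"
    then have "\<forall>\<^sub>F k in sequentially. log_step k < y / 2"
      using log_step_tendsto by (intro order_tendstoD(2)) auto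
    then obtain K where K: "\<And>k. K \<le> k \<Longrightarrow> log_step k < y / 2" unfolding eventually_sequentially by blast
    have "m l < y" if "K \<le> l" for l
    proof -
      have "m l \<le> y / 2" unfolding m_def using K that by (intro cSUP_least) (auto intro: less_imp_le)
      then show ?thesis using y by simp
    qed
    then show "\<forall>\<^sub>F l in sequentially. m l < y" unfolding eventually_sequentially by blast
  qed
  then have "(\<lambda>n. m (last_below (a * z n))) \<longlonglongrightarrow> 0"
    by (rule filterlim_compose[OF _ last_below_scaled_at_top[OF a(1)]])
  then have "(\<lambda>n. m (last_below (a * z n)) * (\<Sum>k\<in>window n a b. log_step k)) \<longlonglongrightarrow> 0 * ln (b / a)"
    by (intro tendsto_mult sum_log_step_tendsto a)
  then show "(\<lambda>n. m (last_below (a * z n)) * (\<Sum>k\<in>window n a b. log_step k)) \<longlonglongrightarrow> 0" by simp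
  show "\<forall>\<^sub>F n in sequentially. (\<Sum>k\<in>window n a b. (log_step k)\<^sup>2)
      \<le> m (last_below (a * z n)) * (\<Sum>k\<in>window n a b. log_step k)"
    using eventually_scaled_ge[OF a(1)]
  proof eventually_elim
    case (elim n)
    show ?case unfolding sum_distrib_left window_eq[OF elim a(2)] power2_eq_square
      by (intro sum_mono mult_right_mono m_ge log_step_nonneg) auto
  qed
  show "\<forall>\<^sub>F n in sequentially. 0 \<le> (\<Sum>k\<in>window n a b. (log_step k)\<^sup>2)"
    by (intro always_eventually allI sum_nonneg) simp
qed simp

end

section \<open>Sums of weighted Dirac masses\<close>

lemma emeasure_weighted_dirac_sum_indicator:
  assumes "\<And>k. 1 \<le> k \<Longrightarrow> 0 < x k" and B: "B \<in> sets pos_borel"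
  shows "emeasure (weighted_dirac_sum m x) B
    = (\<integral>\<^sup>+k. of_nat (m k) * indicator B (x k) \<partial>count_space {1..})"
  using assms by (subst emeasure_weighted_dirac_sum) (auto intro!: nn_integral_cong)

lemma emeasure_weighted_dirac_sum_suminf:
  assumes "\<And>k. 1 \<le> k \<Longrightarrow> 0 < x k" and B: "B \<in> sets pos_borel"
  shows "emeasure (weighted_dirac_sum m x) B = (\<Sum>k. of_nat (m (Suc k)) * indicator B (x (Suc k)))"
proof -
  have "bij_betw Suc UNIV {1..}"
    by (auto simp: bij_betw_def image_iff Suc_le_eq gr0_conv_Suc)
  from nn_integral_bij_count_space[OF this, of "\<lambda>k. of_nat (m k) * indicator B (x k)"]
  show ?thesis using emeasure_weighted_dirac_sum_indicator[where x = x, OF assms]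
    by (simp add: nn_integral_count_space_nat)
qed

lemma emeasure_weighted_dirac_sum_finite:
  assumes x: "\<And>k. 1 \<le> k \<Longrightarrow> 0 < x k" and B: "B \<in> sets pos_borel"
    and J: "finite J" "J \<subseteq> {1..}" "\<And>k. k \<in> J \<Longrightarrow> x k \<in> B"
      "\<And>k. 1 \<le> k \<Longrightarrow> k \<notin> J \<Longrightarrow> m k = 0 \<or> x k \<notin> B"
  shows "emeasure (weighted_dirac_sum m x) B = of_nat (\<Sum>k\<in>J. m k)"
proof -
  have "emeasure (weighted_dirac_sum m x) B = (\<Sum>k\<in>J. of_nat (m k) * indicator B (x k))"
    using emeasure_weighted_dirac_sum_indicator[where x = x, OF x B] J(2,4)
    by (simp only:) (rule nn_integral_count_space'[OF J(1)], auto simp: indicator_def)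
  then show ?thesis using J(3) by simp
qed

text \<open>A sum of natural numbers is a natural number if finitely many terms are non-zero and infinite
  otherwise, since non-zero terms are at least 1.\<close>

lemma weighted_dirac_sum_counting:
  assumes x: "\<And>k. 1 \<le> k \<Longrightarrow> 0 < x k" and fin: "\<And>b. finite {k. x k \<le> b}"
  shows "weighted_dirac_sum m x \<in> counting_measures"
proof -
  have nat: "emeasure (weighted_dirac_sum m x) B \<in> insert \<infinity> (range of_nat)" if B: "B \<in> sets pos_borel" for B
  proof (cases "finite {k. 1 \<le> k \<and> m k \<noteq> 0 \<and> x k \<in> B}")
    case True
    then have "emeasure (weighted_dirac_sum m x) B = of_nat (\<Sum>k | 1 \<le> k \<and> m k \<noteq> 0 \<and> x k \<in> B. m k)"
      by (intro emeasure_weighted_dirac_sum_finite[OF x B]) auto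
    then show ?thesis by blast
  next
    case False
    let ?S = "{k. 1 \<le> k \<and> m k \<noteq> 0 \<and> x k \<in> B}"
    have "\<infinity> = emeasure (count_space {1..}) ?S"
      using False by (subst emeasure_count_space_infinite) auto
    also have "\<dots> = (\<integral>\<^sup>+k. indicator ?S k \<partial>count_space {1..})"
      by (subst nn_integral_indicator) auto
    also have "\<dots> \<le> (\<integral>\<^sup>+k. of_nat (m k) * indicator B (x k) \<partial>count_space {1..})"
    proof (intro nn_integral_mono)
      fix k
      have "m k \<noteq> 0 \<Longrightarrow> (1 :: ennreal) \<le> of_nat (m k)"
        using of_nat_mono[of 1 "m k", where 'a = ennreal] by simp
      then show "indicator ?S k \<le> (of_nat (m k) * indicator B (x k) :: ennreal)"
        by (auto simp: indicator_def)
    qed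
    also have "\<dots> = emeasure (weighted_dirac_sum m x) B"
      by (rule emeasure_weighted_dirac_sum_indicator[where x = x, OF x B, symmetric])
    finally show ?thesis by (simp add: top_unique)
  qed
  have "emeasure (weighted_dirac_sum m x) K < \<infinity>" if K: "compact K" "K \<subseteq> {0<..}" for K
  proof -
    have K': "K \<in> sets pos_borel" using K borel_closed[OF compact_imp_closed[OF K(1)]] by (simp add: sets_pos_borel)
    obtain b where b: "\<And>t. t \<in> K \<Longrightarrow> t \<le> b"
      using compact_imp_bounded[OF K(1)] bounded_imp_bdd_above unfolding bdd_above_def by blast
    have "finite {k. 1 \<le> k \<and> x k \<in> K}" by (rule finite_subset[OF _ fin[of b]]) (use b in auto)
    then have "emeasure (weighted_dirac_sum m x) K = of_nat (\<Sum>k | 1 \<le> k \<and> x k \<in> K. m k)"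
      by (intro emeasure_weighted_dirac_sum_finite[OF x K']) auto
    then show ?thesis by (simp only: infinity_ennreal_def of_nat_less_top)
  qed
  then show ?thesis
    using nat by (auto simp: counting_measures_def locally_finite_measures_def weighted_dirac_sum_def)
qed

lemma integral_weighted_dirac_sum_finite:
  fixes f :: "real \<Rightarrow> real"
  assumes x: "\<And>k. 1 \<le> k \<Longrightarrow> 0 < x k" and f: "f \<in> borel_measurable pos_borel"
    and J: "finite J" "J \<subseteq> {1..}" "\<And>k. 1 \<le> k \<Longrightarrow> k \<notin> J \<Longrightarrow> f (x k) = 0"
  shows "(\<integral>t. f t \<partial>weighted_dirac_sum m x) = (\<Sum>k\<in>J. real (m k) * f (x k))"
proof -
  have mx: "x \<in> measurable (density (count_space {1..}) (\<lambda>k. ennreal (real (m k)))) pos_borel"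
    using x by (auto simp: measurable_def)
  have "(\<integral>t. f t \<partial>weighted_dirac_sum m x) = (\<integral>k. f (x k) \<partial>density (count_space {1..}) (\<lambda>k. ennreal (real (m k))))"
    unfolding weighted_dirac_sum_def ennreal_of_nat_eq_real_of_nat by (rule integral_distr[OF mx f])
  also have "\<dots> = (\<integral>k. real (m k) * f (x k) \<partial>count_space {1..})"
    by (subst integral_density) auto
  also have "\<dots> = (\<Sum>k | k \<in> {1..} \<and> real (m k) * f (x k) \<noteq> 0. real (m k) * f (x k))"
    by (rule lebesgue_integral_count_space_finite_support) (rule finite_subset[OF _ J(1)], use J(3) in auto)
  also have "\<dots> = (\<Sum>k\<in>J. real (m k) * f (x k))"
    by (rule sum.mono_neutral_left[OF J(1)]) (use J(2,3) in auto)
  finally show ?thesis .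
qed

section \<open>Convergence to the Poisson process\<close>

lemma sets_reciprocal_intensity: "sets (reciprocal_intensity c) = sets pos_borel"
  by (simp add: reciprocal_intensity_def pos_borel_def sets_restrict_space)

lemma nn_integral_reciprocal_intensity:
  assumes f: "f \<in> borel_measurable borel"
  shows "(\<integral>\<^sup>+t. f t \<partial>reciprocal_intensity c) = (\<integral>\<^sup>+t. ennreal (c / t) * f t * indicator {0<..} t \<partial>lborel)"
proof -
  have [measurable]: "f \<in> borel_measurable (restrict_space lborel {0<..})"
    using f by (intro measurable_restrict_space1) simp
  have [measurable]: "(\<lambda>t. ennreal (c / t)) \<in> borel_measurable (restrict_space lborel {0<..})"
    by (intro measurable_restrict_space1) measurable
  show ?thesis
    unfolding reciprocal_intensity_def
    by (subst nn_integral_density) (auto simp: nn_integral_restrict_space)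
qed

lemma emeasure_reciprocal_intensity_interval:
  assumes c: "0 < c" and ab: "0 < a" "a \<le> b"
  shows "emeasure (reciprocal_intensity c) {a<..b} = ennreal (c * ln (b / a))"
proof -
  have "emeasure (reciprocal_intensity c) {a<..b} = (\<integral>\<^sup>+t. indicator {a<..b} t \<partial>reciprocal_intensity c)"
    using ab by (subst nn_integral_indicator) (auto simp: sets_reciprocal_intensity interval_in_pos_borel)
  also have "\<dots> = (\<integral>\<^sup>+t. ennreal (c / t) * indicator {a<..b} t * indicator {0<..} t \<partial>lborel)"
    by (rule nn_integral_reciprocal_intensity) simp
  also have "\<dots> = (\<integral>\<^sup>+t. ennreal (c / t) * indicator {a..b} t \<partial>lborel)"
    by (rule nn_integral_cong_AE, use AE_lborel_singleton[of a] in eventually_elim)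
       (use ab in \<open>auto simp: indicator_def\<close>)
  also have "\<dots> = ennreal (c * ln b - c * ln a)"
    using ab c by (intro nn_integral_FTC_Icc) (auto intro!: derivative_eq_intros)
  finally show ?thesis using ab by (simp add: ln_div right_diff_distrib)
qed

lemma measure_reciprocal_intensity_interval:
  assumes "0 < c" "0 < a" "a \<le> b"
  shows "measure (reciprocal_intensity c) {a<..b} = c * ln (b / a)"
  using emeasure_reciprocal_intensity_interval[OF assms] assms by (simp add: measure_def)

locale independent_counts = prob_space M + slowly_growing z
  for M :: "'a measure" and z :: "nat \<Rightarrow> real" +
  fixes c :: real and X :: "nat \<Rightarrow> 'a \<Rightarrow> nat"
  assumes c_pos: "0 < c"
    and indep: "indep_vars (\<lambda>_. count_space UNIV) X {1..}"
    and prob_0: "\<And>k. 1 \<le> k \<Longrightarrow> prob {\<omega> \<in> space M. X k \<omega> = 0} = (z (k - 1) / z k) powr c"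
    and prob_1: "\<And>k. 1 \<le> k \<Longrightarrow> prob {\<omega> \<in> space M. X k \<omega> = 1}
      = prob {\<omega> \<in> space M. X k \<omega> = 0} * (1 - prob {\<omega> \<in> space M. X k \<omega> = 0})"
begin

abbreviation scaled_process :: "nat \<Rightarrow> 'a \<Rightarrow> real measure" where
  "scaled_process n \<omega> \<equiv> weighted_dirac_sum (\<lambda>k. X k \<omega>) (\<lambda>k. z k / z n)"

lemma X_measurable: "1 \<le> k \<Longrightarrow> X k \<in> measurable M (count_space UNIV)"
  using indep unfolding indep_vars_def2 by auto

lemma scaled_pos: "0 < z k / z n"
  using z_pos by simp

lemma finite_scaled_le: "finite {k. z k / z n \<le> b}"
proof -
  have "{k. z k / z n \<le> b} \<subseteq> insert 0 (window n 0 b)"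
    using scaled_pos by (auto simp: window_def Suc_le_eq)
  then show ?thesis by (rule finite_subset) (simp add: finite_window)
qed

lemma scaled_process_point_process: "point_process M (scaled_process n)"
proof -
  have "scaled_process n \<omega> \<in> counting_measures" for \<omega>
    by (rule weighted_dirac_sum_counting[OF scaled_pos finite_scaled_le])
  moreover have "(\<lambda>\<omega>. emeasure (scaled_process n \<omega>) B) \<in> borel_measurable M" if B: "B \<in> sets pos_borel" for B
  proof -
    have [measurable]: "(\<lambda>\<omega>. X (Suc k) \<omega>) \<in> measurable M (count_space UNIV)" for k
      by (rule X_measurable) simp
    have "(\<lambda>\<omega>. \<Sum>k. of_nat (X (Suc k) \<omega>) * indicator B (z (Suc k) / z n) :: ennreal) \<in> borel_measurable M"
      by measurable
    then show ?thesis
      by (subst emeasure_weighted_dirac_sum_suminf[OF scaled_pos B])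
  qed
  ultimately show ?thesis
    using prob_space_axioms by (auto simp: point_process_def counting_measures_def)
qed

lemma scaled_process_interval:
  assumes "0 < a"
  shows "emeasure (scaled_process n \<omega>) {a<..b} = of_nat (\<Sum>k\<in>window n a b. X k \<omega>)"
  using assms
  by (intro emeasure_weighted_dirac_sum_finite scaled_pos interval_in_pos_borel finite_window)
     (auto simp: window_def)

text \<open>Thus \<open>X k\<close> vanishes with the same probability as a Poisson variable of mean \<open>c * log_step k\<close>.\<close>

lemma prob_0_exp:
  assumes "1 \<le> k" shows "prob {\<omega> \<in> space M. X k \<omega> = 0} = exp (- (c * log_step k))"
  using prob_0[OF assms] z_pos
  by (simp add: powr_def log_step_def ln_div less_imp_neq[symmetric] algebra_simps)

lemma prob_window_count_tendsto:
  assumes ab: "0 < a" "a \<le> b"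
  shows "(\<lambda>n. prob {\<omega> \<in> space M. (\<Sum>k\<in>window n a b. X k \<omega>) = m}) \<longlonglongrightarrow> poisson_mass (c * ln (b / a)) m"
proof -
  let ?P = "\<lambda>n. prob {\<omega> \<in> space M. (\<Sum>k\<in>window n a b. X k \<omega>) = m}"
  let ?Q = "\<lambda>n. poisson_mass (\<Sum>k\<in>window n a b. c * log_step k) m"
  have "\<bar>?P n - ?Q n\<bar> \<le> (\<Sum>k\<in>window n a b. 3 * (c * log_step k)\<^sup>2)" for n
  proof (rule poisson_approximation[OF finite_window indep_vars_subset[OF indep window_subset]])
    fix k assume "k \<in> window n a b"
    then have k: "1 \<le> k" by (simp add: window_def)
    show r: "0 \<le> c * log_step k" using c_pos log_step_nonneg by simp
    show "(\<Sum>j\<le>m. \<bar>prob {\<omega> \<in> space M. X k \<omega> = j} - poisson_mass (c * log_step k) j\<bar>)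
        \<le> 3 * (c * log_step k)\<^sup>2" for m
      using prob_1[OF k] prob_0_exp[OF k] by (intro distance_to_poisson_le X_measurable k r) simp_all
  qed
  also have "(\<Sum>k\<in>window n a b. 3 * (c * log_step k)\<^sup>2) = 3 * c\<^sup>2 * (\<Sum>k\<in>window n a b. (log_step k)\<^sup>2)" for n
    by (simp add: sum_distrib_left power_mult_distrib mult.assoc)
  finally have le: "\<bar>?P n - ?Q n\<bar> \<le> 3 * c\<^sup>2 * (\<Sum>k\<in>window n a b. (log_step k)\<^sup>2)" for n .
  have "(\<lambda>n. 3 * c\<^sup>2 * (\<Sum>k\<in>window n a b. (log_step k)\<^sup>2)) \<longlonglongrightarrow> 3 * c\<^sup>2 * 0"
    by (intro tendsto_mult tendsto_const sum_log_step_squared_tendsto ab)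
  then have "(\<lambda>n. 3 * c\<^sup>2 * (\<Sum>k\<in>window n a b. (log_step k)\<^sup>2)) \<longlonglongrightarrow> 0" by simp
  then have diff: "(\<lambda>n. ?P n - ?Q n) \<longlonglongrightarrow> 0"
    by (rule Lim_null_comparison[rotated]) (simp add: le)
  have "(\<lambda>n. c * (\<Sum>k\<in>window n a b. log_step k)) \<longlonglongrightarrow> c * ln (b / a)"
    by (intro tendsto_mult tendsto_const sum_log_step_tendsto ab)
  then have "?Q \<longlonglongrightarrow> poisson_mass (c * ln (b / a)) m"
    unfolding poisson_mass_def sum_distrib_left by (intro tendsto_intros) auto
  from tendsto_add[OF diff this] show ?thesis by simp
qed

lemma prob_window_counts_product:
  assumes I: "finite (I :: nat set)" and disj: "disjoint_family_on (\<lambda>i. {a i<..b i}) I"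
  shows "prob {\<omega> \<in> space M. \<forall>i\<in>I. (\<Sum>k\<in>window n (a i) (b i). X k \<omega>) = v i}
    = (\<Prod>i\<in>I. prob {\<omega> \<in> space M. (\<Sum>k\<in>window n (a i) (b i). X k \<omega>) = v i})"
proof (cases "I = {}")
  case True then show ?thesis by (simp add: prob_space)
next
  case False
  have "indep_vars (\<lambda>i. PiM (window n (a i) (b i)) (\<lambda>_. count_space UNIV))
      (\<lambda>i \<omega>. restrict (\<lambda>k. X k \<omega>) (window n (a i) (b i))) I"
    using window_subset disjoint_windows[OF disj] by (intro indep_vars_restrict[OF indep])
  then have "indep_vars (\<lambda>_. count_space UNIV)
      (\<lambda>i. (\<lambda>f. \<Sum>k\<in>window n (a i) (b i). f k) \<circ> (\<lambda>\<omega>. restrict (\<lambda>k. X k \<omega>) (window n (a i) (b i)))) I"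
    by (rule indep_vars_compose) measurable
  then have iv: "indep_vars (\<lambda>_. count_space UNIV) (\<lambda>i \<omega>. \<Sum>k\<in>window n (a i) (b i). X k \<omega>) I"
    by (simp add: comp_def)
  have "prob (\<Inter>i\<in>I. (\<lambda>\<omega>. \<Sum>k\<in>window n (a i) (b i). X k \<omega>) -` {v i} \<inter> space M)
      = (\<Prod>i\<in>I. prob ((\<lambda>\<omega>. \<Sum>k\<in>window n (a i) (b i). X k \<omega>) -` {v i} \<inter> space M))"
    by (rule indep_varsD[OF iv False I]) auto
  moreover have "(\<Inter>i\<in>I. (\<lambda>\<omega>. \<Sum>k\<in>window n (a i) (b i). X k \<omega>) -` {v i} \<inter> space M)
      = {\<omega> \<in> space M. \<forall>i\<in>I. (\<Sum>k\<in>window n (a i) (b i). X k \<omega>) = v i}"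
    using False by auto
  moreover have "(\<lambda>\<omega>. \<Sum>k\<in>window n (a i) (b i). X k \<omega>) -` {v i} \<inter> space M
      = {\<omega> \<in> space M. (\<Sum>k\<in>window n (a i) (b i). X k \<omega>) = v i}" for i by auto
  ultimately show ?thesis by simp
qed

end

lemma poisson_process_counts_product:
  assumes \<eta>: "poisson_process N \<Lambda> \<eta>" and I: "finite (I :: nat set)" and disj: "disjoint_family_on B I"
    and B: "\<And>i. i \<in> I \<Longrightarrow> B i \<in> sets pos_borel \<and> emeasure \<Lambda> (B i) < \<infinity>"
  shows "measure N {\<omega> \<in> space N. \<forall>i\<in>I. emeasure (\<eta> \<omega>) (B i) = of_nat (v i)}
    = (\<Prod>i\<in>I. poisson_mass (measure \<Lambda> (B i)) (v i))"
proof -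
  interpret N: prob_space N using \<eta> by (simp add: poisson_process_def point_process_def)
  have mass: "measure N {\<omega> \<in> space N. emeasure (\<eta> \<omega>) (B i) = of_nat k} = poisson_mass (measure \<Lambda> (B i)) k"
    if "i \<in> I" for i k using \<eta> B[OF that] by (auto simp: poisson_process_def poisson_mass_def)
  show ?thesis
  proof (cases "I = {}")
    case True then show ?thesis by (simp add: N.prob_space)
  next
    case False
    have iv: "N.indep_vars (\<lambda>_. borel) (\<lambda>i \<omega>. emeasure (\<eta> \<omega>) (B i)) I"
      using \<eta> I disj B unfolding poisson_process_def by blast
    have "N.prob (\<Inter>i\<in>I. (\<lambda>\<omega>. emeasure (\<eta> \<omega>) (B i)) -` {of_nat (v i)} \<inter> space N)
        = (\<Prod>i\<in>I. N.prob ((\<lambda>\<omega>. emeasure (\<eta> \<omega>) (B i)) -` {of_nat (v i)} \<inter> space N))"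
      by (rule N.indep_varsD[OF iv False I]) auto
    moreover have "(\<Inter>i\<in>I. (\<lambda>\<omega>. emeasure (\<eta> \<omega>) (B i)) -` {of_nat (v i)} \<inter> space N)
        = {\<omega> \<in> space N. \<forall>i\<in>I. emeasure (\<eta> \<omega>) (B i) = of_nat (v i)}"
      using False by auto
    moreover have "(\<lambda>\<omega>. emeasure (\<eta> \<omega>) (B i)) -` {of_nat (v i)} \<inter> space N
        = {\<omega> \<in> space N. emeasure (\<eta> \<omega>) (B i) = of_nat (v i)}" for i by auto
    ultimately show ?thesis by (simp add: mass)
  qed
qed

theorem (in independent_counts) scaled_process_converges:
  assumes \<eta>: "poisson_process N (reciprocal_intensity c) \<eta>"
  shows "converges_vaguely_in_distribution (\<lambda>_. M) scaled_process N \<eta>"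
proof (rule converges_vaguely_if_interval_counts_converge)
  show "point_process M (scaled_process n)" for n by (rule scaled_process_point_process)
  show "point_process N \<eta>" using \<eta> by (simp add: poisson_process_def)
next
  fix I :: "nat set" and a b :: "nat \<Rightarrow> real" and v :: "nat \<Rightarrow> nat"
  assume I: "finite I" and disj: "disjoint_family_on (\<lambda>i. {a i<..b i}) I"
    and ab: "\<And>i. i \<in> I \<Longrightarrow> 0 < a i \<and> a i < b i"
  have "{\<omega> \<in> space M. \<forall>i\<in>I. emeasure (scaled_process n \<omega>) {a i<..b i} = of_nat (v i)}
      = {\<omega> \<in> space M. \<forall>i\<in>I. (\<Sum>k\<in>window n (a i) (b i). X k \<omega>) = v i}" for n
    using ab by (auto simp: scaled_process_interval simp del: of_nat_sum)
  then have pre: "prob {\<omega> \<in> space M. \<forall>i\<in>I. emeasure (scaled_process n \<omega>) {a i<..b i} = of_nat (v i)}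
      = (\<Prod>i\<in>I. prob {\<omega> \<in> space M. (\<Sum>k\<in>window n (a i) (b i). X k \<omega>) = v i})" for n
    by (simp add: prob_window_counts_product[OF I disj])
  have "measure N {\<omega> \<in> space N. \<forall>i\<in>I. emeasure (\<eta> \<omega>) {a i<..b i} = of_nat (v i)}
      = (\<Prod>i\<in>I. poisson_mass (measure (reciprocal_intensity c) {a i<..b i}) (v i))"
    using ab c_pos emeasure_reciprocal_intensity_interval
    by (intro poisson_process_counts_product[OF \<eta> I disj])
       (simp add: less_imp_le interval_in_pos_borel)
  also have "\<dots> = (\<Prod>i\<in>I. poisson_mass (c * ln (b i / a i)) (v i))"
    using ab c_pos by (intro prod.cong refl) (simp add: measure_reciprocal_intensity_interval less_imp_le)
  finally have lim: "measure N {\<omega> \<in> space N. \<forall>i\<in>I. emeasure (\<eta> \<omega>) {a i<..b i} = of_nat (v i)}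
      = (\<Prod>i\<in>I. poisson_mass (c * ln (b i / a i)) (v i))" .
  show "(\<lambda>n. prob {\<omega> \<in> space M. \<forall>i\<in>I. emeasure (scaled_process n \<omega>) {a i<..b i} = of_nat (v i)})
      \<longlonglongrightarrow> measure N {\<omega> \<in> space N. \<forall>i\<in>I. emeasure (\<eta> \<omega>) {a i<..b i} = of_nat (v i)}"
    unfolding pre lim using ab by (intro tendsto_prod prob_window_count_tendsto) (blast intro: less_imp_le)+
qed

section \<open>Convergence to the Dickman distribution\<close>

text \<open>A trapezoid: 0 outside \<open>[e / 2, 1]\<close>, 1 on \<open>[e, 1 - e]\<close>, and linear in between.\<close>

definition taper :: "real \<Rightarrow> real \<Rightarrow> real" where
  "taper e t = max 0 (min 1 (min (2 * t / e - 1) ((1 - t) / e)))"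

lemma taper_bounds: "0 \<le> taper e t" "taper e t \<le> 1"
  by (auto simp: taper_def)

lemma taper_eq_1:
  assumes "0 < e" "e \<le> t" "t \<le> 1 - e" shows "taper e t = 1"
proof -
  have "1 \<le> 2 * t / e - 1" "1 \<le> (1 - t) / e" using assms by (simp_all add: le_divide_eq field_simps)
  then show ?thesis by (simp add: taper_def)
qed

lemma taper_eq_0:
  assumes "0 < e" "t \<le> e / 2 \<or> 1 \<le> t" shows "taper e t = 0"
proof -
  have "2 * t / e - 1 \<le> 0 \<or> (1 - t) / e \<le> 0"
    using assms by (auto simp: divide_le_eq divide_nonpos_pos)
  then show ?thesis by (auto simp: taper_def)
qed

lemma tapered_identity_test_function:
  assumes e: "0 < e"
  shows "(\<lambda>t. t * taper e t) \<in> vague_test_functions"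
proof -
  have "continuous_on {0<..} (\<lambda>t. t * taper e t)"
    unfolding taper_def using e by (intro continuous_intros) auto
  moreover have "compact {e / 2..1}" "{e / 2..1} \<subseteq> {0<..}" using e by auto
  ultimately show ?thesis
    using taper_bounds(1)[of e] by (auto simp: vague_test_functions_def taper_eq_0[OF e] intro!: exI[of _ "{e / 2..1}"])
qed

lemma tapered_identity_le:
  assumes "0 < e" "0 < t"
  shows "t * taper e t \<le> t * indicator {0<..<1} t"
proof (cases "t < 1")
  case True
  then show ?thesis using assms taper_bounds[of e t] by (simp add: mult_left_le)
next
  case False
  then have "taper e t = 0" using assms(1) by (intro taper_eq_0) auto
  then show ?thesis using False by simp
qed

lemma tapered_identity_tendsto:
  assumes e: "e \<longlonglongrightarrow> 0" "\<And>j. 0 < e j" and t: "0 < t"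
  shows "(\<lambda>j. t * taper (e j) t) \<longlonglongrightarrow> t * indicator {0<..<1} t"
proof (cases "t < 1")
  case True
  then have "0 < min t (1 - t)" using t by simp
  then have "\<forall>\<^sub>F j in sequentially. e j < min t (1 - t)"
    by (rule order_tendstoD(2)[OF e(1)])
  then have "\<forall>\<^sub>F j in sequentially. t * taper (e j) t = t * indicator {0<..<1} t"
  proof eventually_elim
    case (elim j)
    then show ?case using taper_eq_1[OF e(2)[of j], of t] True t by simp
  qed
  then show ?thesis by (rule tendsto_eventually)
next
  case False
  have "t * taper (e j) t = 0" for j
    using taper_eq_0[OF e(2)[of j], of t] False by simp
  then show ?thesis using False by simp
qed

lemma continuous_map_vague_integral:
  assumes "f \<in> vague_test_functions"
  shows "continuous_map vague_topology euclideanreal (\<lambda>\<mu>. \<integral>t. f t \<partial>\<mu>)"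
  unfolding continuous_map_def
proof safe
  fix U :: "real set" assume "openin euclideanreal U"
  then have "open U" by simp
  then show "openin vague_topology {\<mu> \<in> topspace vague_topology. (\<integral>t. f t \<partial>\<mu>) \<in> U}"
    unfolding topspace_vague_topology using assms unfolding vague_topology_def
    by (intro topology_generated_by_Basis) blast
qed simp

lemma cts_step_lipschitz:
  assumes "x < y"
  shows "\<bar>cts_step x y s - cts_step x y t\<bar> \<le> \<bar>s - t\<bar> / (y - x)"
proof -
  have eq: "cts_step x y s = max 0 (min 1 ((y - s) / (y - x)))" for s
    using assms by (auto simp: cts_step_def max_def min_def field_simps)
  have "\<bar>cts_step x y s - cts_step x y t\<bar> \<le> \<bar>(y - s) / (y - x) - (y - t) / (y - x)\<bar>"
    unfolding eq by linarith
  also have "\<dots> = \<bar>s - t\<bar> / (y - x)"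
    using assms by (simp flip: diff_divide_distrib add: abs_divide)
  finally show ?thesis .
qed

lemma cts_step_bounds: "x < y \<Longrightarrow> 0 \<le> cts_step x y s" "x < y \<Longrightarrow> cts_step x y s \<le> 1"
  by (auto simp: cts_step_def)

lemma continuous_cts_step: "x < y \<Longrightarrow> continuous_on UNIV (cts_step x y)"
  by (intro uniformly_continuous_imp_continuous cts_step_uniformly_continuous)

text \<open>The usual interchange of two limits: \<open>a\<close> is compared with \<open>b j\<close>, whose limit tends to \<open>l\<close>, at the
  price of an error that becomes small in \<open>n\<close> and then \<open>j\<close>.\<close>

lemma LIMSEQ_by_approximation:
  fixes a :: "nat \<Rightarrow> real" and b d :: "nat \<Rightarrow> nat \<Rightarrow> real"
  assumes close: "\<And>j. \<forall>\<^sub>F n in sequentially. \<bar>a n - b j n\<bar> \<le> d j n"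
    and d: "\<And>j. d j \<longlonglongrightarrow> \<delta> j" "\<delta> \<longlonglongrightarrow> 0"
    and b: "\<And>j. b j \<longlonglongrightarrow> \<beta> j" "\<beta> \<longlonglongrightarrow> l"
  shows "a \<longlonglongrightarrow> l"
proof (rule tendstoI)
  fix e :: real assume e: "0 < e"
  have "\<forall>\<^sub>F j in sequentially. \<delta> j < e / 4" using d(2) e by (intro order_tendstoD(2)) auto
  moreover have "\<forall>\<^sub>F j in sequentially. dist (\<beta> j) l < e / 4" using b(2) e by (intro tendstoD) auto
  ultimately have "\<forall>\<^sub>F j in sequentially. \<delta> j < e / 4 \<and> dist (\<beta> j) l < e / 4" by eventually_elim simp
  then obtain j where j: "\<delta> j < e / 4" "dist (\<beta> j) l < e / 4"
    by (auto simp: eventually_sequentially)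
  have "\<forall>\<^sub>F n in sequentially. d j n < e / 4" using d(1) j(1) by (rule order_tendstoD(2))
  moreover have "\<forall>\<^sub>F n in sequentially. dist (b j n) (\<beta> j) < e / 4" using b(1) e by (intro tendstoD) auto
  ultimately show "\<forall>\<^sub>F n in sequentially. dist (a n) l < e"
    using close[of j]
  proof eventually_elim
    case (elim n)
    then show ?case using j(2) e unfolding dist_real_def by linarith
  qed
qed

text \<open>Rounding the exponent up to an integer decreases the power, and for integer exponents this is
  Bernoulli's inequality.\<close>

lemma one_minus_powr_le:
  assumes x: "0 < x" "x \<le> (1 :: real)" and c: "0 < c"
  shows "1 - x powr c \<le> real (nat \<lceil>c\<rceil>) * (1 - x)"
proof -
  have "1 + real (nat \<lceil>c\<rceil>) * (x - 1) \<le> (1 + (x - 1)) ^ nat \<lceil>c\<rceil>"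
    using x by (intro Bernoulli_inequality) simp
  also have "\<dots> = x powr real (nat \<lceil>c\<rceil>)" using x by (simp add: powr_realpow)
  also have "\<dots> \<le> x powr c" using x by (intro powr_mono' real_nat_ceiling_ge) auto
  finally show ?thesis by (simp add: algebra_simps)
qed

lemma unit_interval_identity_measurable: "(\<lambda>t :: real. ennreal t * indicator {0<..<1} t) \<in> borel_measurable pos_borel"
  unfolding pos_borel_def by (intro measurable_restrict_space1) measurable

lemma dickman_integral_measurable:
  assumes pp: "point_process N \<eta>"
  shows "(\<lambda>\<omega>. \<integral>\<^sup>+t\<in>{0<..<1}. ennreal t \<partial>\<eta> \<omega>) \<in> borel_measurable N"
  by (rule point_process_nn_integral_measurable[OF pp unit_interval_identity_measurable])

lemma dickman_variable_measurable:
  assumes "point_process N \<eta>"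
  shows "dickman_variable \<eta> \<in> borel_measurable N"
  unfolding dickman_variable_def[abs_def]
  by (intro measurable_compose[OF dickman_integral_measurable[OF assms]]) simp

text \<open>By Campbell's formula the mean is the integral of \<open>t * (c / t)\<close> over \<open>(0, 1)\<close>, which is \<open>c\<close>.
  Finiteness matters because \<^const>\<open>dickman_variable\<close> would otherwise send an infinite integral to 0.\<close>

lemma dickman_integral_finite:
  assumes c: "0 < c" and \<eta>: "poisson_process N (reciprocal_intensity c) \<eta>"
  shows "AE \<omega> in N. (\<integral>\<^sup>+t\<in>{0<..<1}. ennreal t \<partial>\<eta> \<omega>) < \<infinity>"
proof -
  have pp: "point_process N \<eta>" using \<eta> by (simp add: poisson_process_def)
  have "(\<integral>\<^sup>+\<omega>. (\<integral>\<^sup>+t\<in>{0<..<1}. ennreal t \<partial>\<eta> \<omega>) \<partial>N)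
      = (\<integral>\<^sup>+t\<in>{0<..<1}. ennreal t \<partial>reciprocal_intensity c)"
    by (rule campbell_formula[OF pp sets_reciprocal_intensity poisson_process_mean[OF \<eta>] unit_interval_identity_measurable])
  also have "\<dots> = (\<integral>\<^sup>+t. ennreal (c / t) * (ennreal t * indicator {0<..<1} t) * indicator {0<..} t \<partial>lborel)"
    by (rule nn_integral_reciprocal_intensity) measurable
  also have "\<dots> = (\<integral>\<^sup>+t. ennreal c * indicator {0<..<1 :: real} t \<partial>lborel)"
    using c by (intro nn_integral_cong) (auto simp: indicator_def simp flip: ennreal_mult')
  also have "\<dots> = ennreal c" by (subst nn_integral_cmult_indicator) auto
  finally have "(\<integral>\<^sup>+\<omega>. (\<integral>\<^sup>+t\<in>{0<..<1}. ennreal t \<partial>\<eta> \<omega>) \<partial>N) \<noteq> \<infinity>" by simp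
  from nn_integral_PInf_AE[OF dickman_integral_measurable[OF pp] this]
  show ?thesis by eventually_elim (simp add: less_top[symmetric])
qed

lemma tapered_integral_tendsto_dickman:
  assumes pp: "point_process N \<eta>"
    and fin: "AE \<omega> in N. (\<integral>\<^sup>+t\<in>{0<..<1}. ennreal t \<partial>\<eta> \<omega>) < \<infinity>"
    and e: "e \<longlonglongrightarrow> 0" "\<And>j. 0 < e j"
  shows "AE \<omega> in N. (\<lambda>j. \<integral>t. t * taper (e j) t \<partial>\<eta> \<omega>) \<longlonglongrightarrow> dickman_variable \<eta> \<omega>"
  using fin AE_space
proof eventually_elim
  case (elim \<omega>)
  have lf: "\<eta> \<omega> \<in> locally_finite_measures" by (rule point_process_locally_finite[OF pp elim(2)])
  note space = space_locally_finite[OF lf]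
  define w where "w t = t * indicator {0<..<1} t" for t :: real
  have "w \<in> borel_measurable pos_borel"
    unfolding w_def pos_borel_def by (intro measurable_restrict_space1) measurable
  then have wm: "w \<in> borel_measurable (\<eta> \<omega>)"
    using measurable_cong_sets[OF sets_locally_finite[OF lf] refl] by blast
  have nn: "(\<integral>\<^sup>+t. ennreal (w t) \<partial>\<eta> \<omega>) = (\<integral>\<^sup>+t\<in>{0<..<1}. ennreal t \<partial>\<eta> \<omega>)"
    by (intro nn_integral_cong) (auto simp: w_def indicator_def)
  have w_nonneg: "0 \<le> w t" for t by (auto simp: w_def indicator_def)
  have wi: "integrable (\<eta> \<omega>) w"
    using wm nn elim(1) w_nonneg by (intro integrableI_nonneg) auto
  have "(\<lambda>j. \<integral>t. t * taper (e j) t \<partial>\<eta> \<omega>) \<longlonglongrightarrow> (\<integral>t. w t \<partial>\<eta> \<omega>)"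
  proof (rule integral_dominated_convergence[OF wm _ wi])
    show "(\<lambda>t. t * taper (e j) t) \<in> borel_measurable (\<eta> \<omega>)" for j
      using test_function_integrable[OF tapered_identity_test_function[OF e(2)] lf] by simp
    show "AE t in \<eta> \<omega>. (\<lambda>j. t * taper (e j) t) \<longlonglongrightarrow> w t"
      unfolding w_def by (intro AE_I2 tapered_identity_tendsto e) (simp add: space)
    show "AE t in \<eta> \<omega>. norm (t * taper (e j) t) \<le> w t" for j
    proof (rule AE_I2)
      fix t assume "t \<in> space (\<eta> \<omega>)"
      then have "0 < t" by (simp add: space)
      with tapered_identity_le[OF e(2) this, of j] taper_bounds(1)[of "e j" t]
      show "norm (t * taper (e j) t) \<le> w t" by (simp add: w_def abs_mult)
    qed
  qed
  also have "(\<integral>t. w t \<partial>\<eta> \<omega>) = dickman_variable \<eta> \<omega>"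
    using wm w_nonneg by (subst integral_eq_nn_integral) (auto simp: nn dickman_variable_def)
  finally show ?case .
qed

context independent_counts
begin

definition scaled_sum :: "nat \<Rightarrow> 'a \<Rightarrow> real" where
  "scaled_sum n \<omega> = (\<Sum>k = 1..n. z k * real (X k \<omega>)) / z n"

lemma real_X_measurable: "1 \<le> k \<Longrightarrow> (\<lambda>\<omega>. real (X k \<omega>)) \<in> borel_measurable M"
  by (rule measurable_compose[OF X_measurable]) simp_all

lemma scaled_sum_measurable: "scaled_sum n \<in> borel_measurable M"
  unfolding scaled_sum_def[abs_def]
  by (intro borel_measurable_divide borel_measurable_sum borel_measurable_times borel_measurable_const real_X_measurable) auto

lemma scaled_sum_minus_tapered:
  assumes e: "0 < e"
  shows "scaled_sum n \<omega> - (\<integral>t. t * taper e t \<partial>scaled_process n \<omega>)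
    = (\<Sum>k\<in>{1..n}. (z k / z n) * (1 - taper e (z k / z n)) * real (X k \<omega>))"
proof -
  have "(\<integral>t. t * taper e t \<partial>scaled_process n \<omega>) = (\<Sum>k\<in>{1..n}. real (X k \<omega>) * (z k / z n * taper e (z k / z n)))"
  proof (rule integral_weighted_dirac_sum_finite)
    show "(\<lambda>t. t * taper e t) \<in> borel_measurable pos_borel"
      by (rule test_function_measurable[OF tapered_identity_test_function[OF e]])
    fix k assume "1 \<le> k" "k \<notin> {1..n}"
    then have "1 \<le> z k / z n" using monoD[OF z_mono, of n k] z_pos[of n] by simp
    then have "z k / z n * taper e (z k / z n) \<le> 0"
      using tapered_identity_le[OF e scaled_pos, of k n] by simp
    then show "z k / z n * taper e (z k / z n) = 0"
      using taper_bounds(1)[of e "z k / z n"] scaled_pos[of k n] by (meson antisym less_imp_le mult_nonneg_nonneg)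
  qed (auto simp: scaled_pos)
  then show ?thesis
    unfolding scaled_sum_def sum_divide_distrib by (simp only: sum_subtractf[symmetric])
      (intro sum.cong refl, simp add: algebra_simps)
qed

text \<open>Up to the factor \<open>C\<close> the left-hand side bounds the mean contribution of the point \<open>z k\<close>, and the
  right-hand side telescopes.\<close>

lemma increment_bound:
  assumes k: "1 \<le> k"
  shows "z k * prob {\<omega> \<in> space M. X k \<omega> = 1} \<le> real (nat \<lceil>c\<rceil>) * (z k - z (k - 1))"
proof -
  let ?q = "prob {\<omega> \<in> space M. X k \<omega> = 0}"
  have x: "0 < z (k - 1) / z k" "z (k - 1) / z k \<le> 1"
    using z_pos monoD[OF z_mono, of "k - 1" k] by auto
  have "prob {\<omega> \<in> space M. X k \<omega> = 1} \<le> 1 * (1 - ?q)"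
    unfolding prob_1[OF k] by (intro mult_right_mono) auto
  also have "\<dots> \<le> real (nat \<lceil>c\<rceil>) * (1 - z (k - 1) / z k)"
    using one_minus_powr_le[OF x c_pos] by (simp add: prob_0[OF k])
  finally have "z k * prob {\<omega> \<in> space M. X k \<omega> = 1} \<le> z k * (real (nat \<lceil>c\<rceil>) * (1 - z (k - 1) / z k))"
    using z_pos[of k] by (intro mult_left_mono) auto
  also have "\<dots> = real (nat \<lceil>c\<rceil>) * (z k - z (k - 1))"
    using z_pos[of k] by (simp add: right_diff_distrib)
  finally show ?thesis .
qed

text \<open>The taper differs from 1 only for points up to \<open>e z\<^sub>n\<close> and for points in \<open>((1 - e) z\<^sub>n, z\<^sub>n]\<close>; the
  increments over each of the two ranges of indices telescope.\<close>

lemma sum_outside_taper_le: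
  assumes e: "0 < e" "e \<le> 1 / 2" and n: "z 0 \<le> e * z n"
  shows "(\<Sum>k\<in>{1..n}. (z k - z (k - 1)) * (1 - taper e (z k / z n)))
    \<le> z (last_below (e * z n)) + (z n - z (last_below ((1 - e) * z n)))"
proof -
  let ?l = "last_below (e * z n)" and ?u = "last_below ((1 - e) * z n)"
  have n': "z 0 \<le> (1 - e) * z n"
    using e z_pos[of n] by (intro order_trans[OF n] mult_right_mono) auto
  have lu: "?l \<le> ?u" using e z_pos[of n] n by (intro last_below_mono mult_right_mono) auto
  have un: "?u \<le> n"
  proof (rule ccontr)
    assume "\<not> ?u \<le> n"
    then have "z n \<le> (1 - e) * z n" using le_iff_le_last_below[OF n', of n] by simp
    then show False using mult_pos_pos[OF e(1) z_pos[of n]] by (simp add: algebra_simps)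
  qed
  have inc: "0 \<le> z k - z (k - 1)" for k using monoD[OF z_mono, of "k - 1" k] by simp
  have "(\<Sum>k\<in>{1..n}. (z k - z (k - 1)) * (1 - taper e (z k / z n)))
      \<le> (\<Sum>k\<in>{1..n}. if k \<in> {0<..?l} \<union> {?u<..n} then z k - z (k - 1) else 0)"
  proof (intro sum_mono)
    fix k assume k: "k \<in> {1..n}"
    show "(z k - z (k - 1)) * (1 - taper e (z k / z n))
        \<le> (if k \<in> {0<..?l} \<union> {?u<..n} then z k - z (k - 1) else 0)"
    proof (cases "k \<in> {0<..?l} \<union> {?u<..n}")
      case True
      then show ?thesis using inc[of k] taper_bounds[of e "z k / z n"] by (simp add: mult_left_le)
    next
      case False
      then have "e * z n < z k" "z k \<le> (1 - e) * z n"
        using k le_iff_le_last_below[OF n, of k] le_iff_le_last_below[OF n', of k] by auto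
      then have "taper e (z k / z n) = 1"
        using z_pos[of n] by (intro taper_eq_1 e) (simp_all add: pos_le_divide_eq pos_divide_le_eq)
      then show ?thesis using False inc[of k] by auto
    qed
  qed
  also have "\<dots> = (\<Sum>k\<in>{0<..?l} \<union> {?u<..n}. z k - z (k - 1))"
    using lu un by (intro sum.mono_neutral_cong_right) auto
  also have "\<dots> = (z ?l - z 0) + (z n - z ?u)"
    using lu sum_increments[of 0 ?l z] sum_increments[OF un, of z] by (subst sum.union_disjoint) auto
  finally show ?thesis using z_pos[of 0] by simp
qed

text \<open>It suffices to test with the piecewise linear functions \<^const>\<open>cts_step\<close>. They are Lipschitz, so
  replacing the sum by the tapered integral costs at most a multiple of the mean difference; the
  tapered integral is a vaguely continuous functional of the point process.\<close>

theorem scaled_sum_converges: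
  assumes \<eta>: "poisson_process N (reciprocal_intensity c) \<eta>"
    and C: "0 < C" "\<And>k. 1 \<le> k \<Longrightarrow> integrable M (\<lambda>\<omega>. real (X k \<omega>))"
      "\<And>k. 1 \<le> k \<Longrightarrow> (\<integral>\<omega>. real (X k \<omega>) \<partial>M) \<le> C * prob {\<omega> \<in> space M. X k \<omega> = 1}"
  shows "weak_conv_m (\<lambda>n. distr M borel (scaled_sum n)) (distr N borel (dickman_variable \<eta>))"
proof (rule integral_cts_step_conv_imp_weak_conv)
  have pp: "point_process N \<eta>" using \<eta> by (simp add: poisson_process_def)
  interpret N: prob_space N using \<eta> by (simp add: poisson_process_def point_process_def)
  show "real_distribution (distr M borel (scaled_sum n))" for n
    by (rule real_distribution_distr[OF scaled_sum_measurable])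
  show "real_distribution (distr N borel (dickman_variable \<eta>))"
    by (rule N.real_distribution_distr[OF dickman_variable_measurable[OF pp]])
  fix x y :: real assume xy: "x < y"
  let ?\<phi> = "cts_step x y"
  have \<phi>m: "?\<phi> \<in> borel_measurable borel"
    using continuous_cts_step[OF xy] by (rule borel_measurable_continuous_onI)
  \<comment> \<open>Widths tending to 0 and not above \<open>1 / 2\<close>, so that the two tapered ends do not overlap.\<close>
  define e where "e j = inverse (real (Suc (Suc j)))" for j
  have e: "e \<longlonglongrightarrow> 0" "\<And>j. 0 < e j" "\<And>j. e j \<le> 1 / 2"
    using LIMSEQ_Suc[OF LIMSEQ_inverse_real_of_nat] by (auto simp: e_def[abs_def] divide_simps)
  define f where "f j t = t * taper (e j) t" for j t
  have f: "f j \<in> vague_test_functions" for j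
    unfolding f_def using e(2) by (rule tapered_identity_test_function)
  define A where "A = C * real (nat \<lceil>c\<rceil>)"
  have A: "0 \<le> A" using C(1) by (simp add: A_def)
  note conv = scaled_process_converges[OF \<eta>, unfolded converges_vaguely_in_distribution_def converges_in_distribution_def]
  have F: "continuous_map vague_topology euclideanreal (\<lambda>\<mu>. ?\<phi> (\<integral>t. f j t \<partial>\<mu>))" for j
    using continuous_map_compose[OF continuous_map_vague_integral[OF f, of j], of euclideanreal ?\<phi>]
      continuous_cts_step[OF xy] by (simp add: comp_def)
  let ?d = "\<lambda>j n. A / (y - x) * (z (last_below (e j * z n)) / z n + 1 - z (last_below ((1 - e j) * z n)) / z n)"
  let ?\<delta> = "\<lambda>j. A / (y - x) * (e j + 1 - (1 - e j))"
  let ?b = "\<lambda>j n. \<integral>\<omega>. ?\<phi> (\<integral>t. f j t \<partial>scaled_process n \<omega>) \<partial>M"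
  let ?\<beta> = "\<lambda>j. \<integral>\<omega>. ?\<phi> (\<integral>t. f j t \<partial>\<eta> \<omega>) \<partial>N"
  have main: "(\<lambda>n. \<integral>\<omega>. ?\<phi> (scaled_sum n \<omega>) \<partial>M) \<longlonglongrightarrow> (\<integral>\<omega>. ?\<phi> (dickman_variable \<eta> \<omega>) \<partial>N)"
  proof (rule LIMSEQ_by_approximation[where d = ?d and \<delta> = ?\<delta> and b = ?b and \<beta> = ?\<beta>])
    show "(\<lambda>n. \<integral>\<omega>. ?\<phi> (\<integral>t. f j t \<partial>scaled_process n \<omega>) \<partial>M) \<longlonglongrightarrow> (\<integral>\<omega>. ?\<phi> (\<integral>t. f j t \<partial>\<eta> \<omega>) \<partial>N)" for j
    proof -
      have "bounded ((\<lambda>\<mu>. ?\<phi> (\<integral>t. f j t \<partial>\<mu>)) ` topspace vague_topology)"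
        unfolding bounded_iff using cts_step_bounds[OF xy] by (intro exI[of _ 1]) (auto simp: abs_le_iff intro: order_trans[of _ 0])
      then show ?thesis using conv F[of j] by blast
    qed
    show "(\<lambda>j. \<integral>\<omega>. ?\<phi> (\<integral>t. f j t \<partial>\<eta> \<omega>) \<partial>N) \<longlonglongrightarrow> (\<integral>\<omega>. ?\<phi> (dickman_variable \<eta> \<omega>) \<partial>N)"
    proof (rule integral_dominated_convergence[where w = "\<lambda>_. 1"])
      show "(\<lambda>\<omega>. ?\<phi> (dickman_variable \<eta> \<omega>)) \<in> borel_measurable N"
        by (rule measurable_compose[OF dickman_variable_measurable[OF pp] \<phi>m])
      show "(\<lambda>\<omega>. ?\<phi> (\<integral>t. f j t \<partial>\<eta> \<omega>)) \<in> borel_measurable N" for j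
        by (rule vaguely_continuous_measurable[OF pp F cts_step_bounds(1)[OF xy]])
      show "AE \<omega> in N. (\<lambda>j. ?\<phi> (\<integral>t. f j t \<partial>\<eta> \<omega>)) \<longlonglongrightarrow> ?\<phi> (dickman_variable \<eta> \<omega>)"
        using tapered_integral_tendsto_dickman[OF pp dickman_integral_finite[OF c_pos \<eta>] e(1,2)]
        by eventually_elim
          (rule continuous_on_tendsto_compose[OF continuous_cts_step[OF xy]], simp_all add: f_def)
      show "AE \<omega> in N. norm (?\<phi> (\<integral>t. f j t \<partial>\<eta> \<omega>)) \<le> 1" for j
        using cts_step_bounds[OF xy] by (intro AE_I2) simp
    qed simp
    show "(\<lambda>n. ?d j n) \<longlonglongrightarrow> A / (y - x) * (e j + 1 - (1 - e j))" for j
      using e(2,3)[of j] by (intro tendsto_intros last_below_scaled_asymp) auto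
    have "(\<lambda>j. A / (y - x) * (e j + 1 - (1 - e j))) \<longlonglongrightarrow> A / (y - x) * (0 + 1 - (1 - 0))"
      by (intro tendsto_intros e(1))
    then show "(\<lambda>j. A / (y - x) * (e j + 1 - (1 - e j))) \<longlonglongrightarrow> 0" by simp
    show "\<forall>\<^sub>F n in sequentially. \<bar>(\<integral>\<omega>. ?\<phi> (scaled_sum n \<omega>) \<partial>M)
        - (\<integral>\<omega>. ?\<phi> (\<integral>t. f j t \<partial>scaled_process n \<omega>) \<partial>M)\<bar> \<le> ?d j n" for j
      using eventually_scaled_ge[OF e(2)[of j]]
    proof eventually_elim
      case (elim n)
      let ?I = "\<lambda>\<omega>. \<integral>t. f j t \<partial>scaled_process n \<omega>"
      define g where "g k = (z k / z n) * (1 - taper (e j) (z k / z n))" for k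
      have g: "0 \<le> g k" for k
        unfolding g_def using taper_bounds(2) less_imp_le[OF scaled_pos] by (intro mult_nonneg_nonneg) auto
      have gap: "scaled_sum n \<omega> - ?I \<omega> = (\<Sum>k\<in>{1..n}. g k * real (X k \<omega>))" for \<omega>
        unfolding f_def g_def by (rule scaled_sum_minus_tapered[OF e(2)])
      have gap_int: "integrable M (\<lambda>\<omega>. \<Sum>k\<in>{1..n}. g k * real (X k \<omega>))"
        using C(2) by (intro Bochner_Integration.integrable_sum integrable_mult_right) auto
      have i1: "integrable M (\<lambda>\<omega>. ?\<phi> (scaled_sum n \<omega>))"
        using cts_step_bounds[OF xy]
        by (intro integrable_const_bound[of _ 1] AE_I2 measurable_compose[OF scaled_sum_measurable \<phi>m]) simp
      have i2: "integrable M (\<lambda>\<omega>. ?\<phi> (?I \<omega>))"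
        using cts_step_bounds[OF xy]
        by (intro integrable_const_bound[of _ 1] AE_I2
            vaguely_continuous_measurable[OF scaled_process_point_process F cts_step_bounds(1)[OF xy]]) simp
      have "\<bar>(\<integral>\<omega>. ?\<phi> (scaled_sum n \<omega>) \<partial>M) - (\<integral>\<omega>. ?\<phi> (?I \<omega>) \<partial>M)\<bar>
          = \<bar>\<integral>\<omega>. ?\<phi> (scaled_sum n \<omega>) - ?\<phi> (?I \<omega>) \<partial>M\<bar>"
        using i1 i2 by simp
      also have "\<dots> \<le> (\<integral>\<omega>. \<bar>?\<phi> (scaled_sum n \<omega>) - ?\<phi> (?I \<omega>)\<bar> \<partial>M)"
        by (rule integral_abs_bound)
      also have "\<dots> \<le> (\<integral>\<omega>. (\<Sum>k\<in>{1..n}. g k * real (X k \<omega>)) / (y - x) \<partial>M)"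
      proof (rule integral_mono)
        show "\<bar>?\<phi> (scaled_sum n \<omega>) - ?\<phi> (?I \<omega>)\<bar> \<le> (\<Sum>k\<in>{1..n}. g k * real (X k \<omega>)) / (y - x)" for \<omega>
        proof -
          have "0 \<le> (\<Sum>k\<in>{1..n}. g k * real (X k \<omega>))" using g by (intro sum_nonneg) simp
          then show ?thesis using cts_step_lipschitz[OF xy, of "scaled_sum n \<omega>" "?I \<omega>"] by (simp only: gap abs_of_nonneg)
        qed
      qed (use i1 i2 gap_int in auto)
      also have "\<dots> = (\<Sum>k\<in>{1..n}. g k * (\<integral>\<omega>. real (X k \<omega>) \<partial>M)) / (y - x)"
        using C(2) by (simp add: Bochner_Integration.integral_sum)
      also have "\<dots> \<le> (\<Sum>k\<in>{1..n}. A / z n * ((z k - z (k - 1)) * (1 - taper (e j) (z k / z n)))) / (y - x)"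
      proof (intro divide_right_mono sum_mono)
        fix k assume "k \<in> {1..n}"
        then have k: "1 \<le> k" by simp
        have t: "0 \<le> (1 - taper (e j) (z k / z n)) / z n"
          using taper_bounds(2)[of "e j" "z k / z n"] z_pos[of n] by simp
        have "g k * (\<integral>\<omega>. real (X k \<omega>) \<partial>M) \<le> g k * (C * prob {\<omega> \<in> space M. X k \<omega> = 1})"
          by (intro mult_left_mono C(3) k g)
        also have "\<dots> = (1 - taper (e j) (z k / z n)) / z n * (C * (z k * prob {\<omega> \<in> space M. X k \<omega> = 1}))"
          by (simp add: g_def)
        also have "\<dots> \<le> (1 - taper (e j) (z k / z n)) / z n * (C * (real (nat \<lceil>c\<rceil>) * (z k - z (k - 1))))"
          using C(1) by (intro mult_left_mono increment_bound k t) auto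
        also have "\<dots> = A / z n * ((z k - z (k - 1)) * (1 - taper (e j) (z k / z n)))"
          by (simp add: A_def)
        finally show "g k * (\<integral>\<omega>. real (X k \<omega>) \<partial>M) \<le> A / z n * ((z k - z (k - 1)) * (1 - taper (e j) (z k / z n)))" .
      qed (use xy in simp)
      also have "\<dots> = A / (y - x) / z n * (\<Sum>k\<in>{1..n}. (z k - z (k - 1)) * (1 - taper (e j) (z k / z n)))"
        unfolding sum_distrib_left[symmetric] by simp
      also have "\<dots> \<le> A / (y - x) / z n * (z (last_below (e j * z n)) + (z n - z (last_below ((1 - e j) * z n))))"
        using A xy z_pos[of n] e(2,3)[of j] elim
        by (intro mult_left_mono sum_outside_taper_le) auto
      also have "\<dots> = A / (y - x) *
          ((z (last_below (e j * z n)) + (z n - z (last_below ((1 - e j) * z n)))) / z n)"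
        by simp
      also have "\<dots> = ?d j n"
        using less_imp_neq[OF z_pos[of n]] by (simp only: add_divide_distrib diff_divide_distrib) simp
      finally show ?case .
    qed
  qed
  show "(\<lambda>n. \<integral>u. ?\<phi> u \<partial>distr M borel (scaled_sum n)) \<longlonglongrightarrow> (\<integral>u. ?\<phi> u \<partial>distr N borel (dickman_variable \<eta>))"
    using main by (simp add: integral_distr[OF scaled_sum_measurable \<phi>m]
        integral_distr[OF dickman_variable_measurable[OF pp] \<phi>m])
qed

end

theorem theorem3p3:
  fixes M :: "'a measure" and N :: "'b measure"
    and z :: "nat \<Rightarrow> real" and c :: real
    and X :: "nat \<Rightarrow> 'a \<Rightarrow> nat" and \<eta> :: "'b \<Rightarrow> real measure"
  assumes "prob_space M"
    and "\<And>k. z k > 0" and "mono z" and "filterlim z at_top sequentially"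
    and "(\<lambda>k. z (Suc k) / z k) \<longlonglongrightarrow> 1"
    and "c > 0"
    and "prob_space.indep_vars M (\<lambda>_. count_space UNIV) X {1..}"
    and "\<And>k. k \<ge> 1 \<Longrightarrow> measure M {\<omega> \<in> space M. X k \<omega> = 0} = (z (k - 1) / z k) powr c"
    and "\<And>k. k \<ge> 1 \<Longrightarrow> measure M {\<omega> \<in> space M. X k \<omega> = 1} =
           measure M {\<omega> \<in> space M. X k \<omega> = 0} * (1 - measure M {\<omega> \<in> space M. X k \<omega> = 0})"
    and "poisson_process N (reciprocal_intensity c) \<eta>"
  shows "converges_vaguely_in_distribution
           (\<lambda>_. M) (\<lambda>n \<omega>. weighted_dirac_sum (\<lambda>k. X k \<omega>) (\<lambda>k. z k / z n)) N \<eta> \<and>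
         ((\<exists>C>0. \<forall>k\<ge>1. integrable M (\<lambda>\<omega>. real (X k \<omega>)) \<and>
             (\<integral>\<omega>. real (X k \<omega>) \<partial>M) \<le> C * measure M {\<omega> \<in> space M. X k \<omega> = 1}) \<longrightarrow>
          weak_conv_m
            (\<lambda>n. distr M borel (\<lambda>\<omega>. (\<Sum>k = 1..n. z k * real (X k \<omega>)) / z n))
            (distr N borel (dickman_variable \<eta>)))"
proof -
  interpret independent_counts M z c X
    by (intro independent_counts.intro slowly_growing.intro independent_counts_axioms.intro assms)
  have "weak_conv_m (\<lambda>n. distr M borel (scaled_sum n)) (distr N borel (dickman_variable \<eta>))"
    if "C > 0" "\<forall>k\<ge>1. integrable M (\<lambda>\<omega>. real (X k \<omega>)) \<and>
          (\<integral>\<omega>. real (X k \<omega>) \<partial>M) \<le> C * measure M {\<omega> \<in> space M. X k \<omega> = 1}" for C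
    using that by (intro scaled_sum_converges[OF assms(10)]) auto
  then show ?thesis
    using scaled_process_converges[OF assms(10)] by (auto simp: scaled_sum_def[abs_def])
qed

end
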